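(* For all positive integers $n,m$, the bounded-error quantum query complexity of $f_{n,m}$ satisfies $Q(f_{n,m})=\tilde O(\sqrt n+\sqrt m)$.
   Context: Let $n,m$ be positive integers, $M=[n]\times[m]$ (a grid of cells with $n$ rows and $m$ columns), $\tilde M = M\cup\{\bot\}$ (pointers to cells, $\bot$ is the null pointer) and $\tilde C=[m]\cup\{\bot\}$ (pointers to columns). Let $T$ be the following fixed binary tree with $m$ leaves and $m-1$ internal nodes: if $m=2^k$, $T$ is the complete binary tree with $2^k$ leaves; if $2^k<m<2^{k+1}$, take the complete binary tree with $2^k$ leaves and add a pair of children to each of its $m-2^k$ leftmost leaves. The two outgoing arcs of each internal node are labeled 'left' and 'right', and the leaves are labeled $1,\dots,m$ from left to right. For a leaf $j$, $T(j)$ denotes the sequence of 'left'/'right' labels on the path from the root to leaf $j$. The input alphabet is $\Sigma=\{0,1\}\times\tilde M\times\tilde M\times\tilde C$; for $v\in\Sigma$ its four components are called $\mathrm{val}(v)$, $\mathrm{lpoint}(v)$, $\mathrm{rpoint}(v)$, $\mathrm{bpoint}(v)$. The function $f_{n,m}\colon\Sigma^M\to\{0,1\}$ is defined by $f_{n,m}(x)=1$ iff: (1) there is exactly one column $b\in[m]$ with $\mathrm{val}(x_{i,b})=1$ for all $i\in[n]$ (the marked column); (2) in column $b$ there is a unique cell $a$ with $x_a\ne(1,\bot,\bot,\bot)$ (the special element); (3) for each column $j\in[m]\setminus\{b\}$, the path starting at $a$ and following the pointers $\mathrm{lpoint},\mathrm{rpoint}$ as specified by the sequence $T(j)$ exists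 (no pointer on it is $\bot$) and ends in a cell $\ell_j$ lying in column $j$ with $\mathrm{val}(x_{\ell_j})=0$; (4) $\mathrm{bpoint}(x_{\ell_j})=b$ for every $j\in[m]\setminus\{b\}$. $Q(f)$ is the minimum number of queries of a quantum query algorithm that outputs $f(x)$ with probability at least $9/10$ on every input $x$; identifying $\Sigma$ with $[|\Sigma|]$, the query on input $x$ is the unitary $O_x|c,p\rangle|w\rangle=|c,\,p+x_c \bmod |\Sigma|\rangle|w\rangle$ for $c\in M$, $p\in\Sigma$. $\tilde O(\cdot)$ hides factors polylogarithmic in $n$ and $m$. *)

theory Defs
  imports Complex_Main
begin

text \<open>Cells are pairs (i,j) with 1 \<le> i \<le> n (row) and 1 \<le> j \<le> m (column).
  A symbol of the alphabet Sigma is a tuple (val, lpoint, rpoint, bpoint) where val = True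
  stands for 1, and None stands for the null pointer.\<close>

type_synonym cell = "nat \<times> nat"
type_synonym sym = "bool \<times> cell option \<times> cell option \<times> nat option"

definition cells :: "nat \<Rightarrow> nat \<Rightarrow> cell set" where
  "cells n m = {1..n} \<times> {1..m}"

definition sval :: "sym \<Rightarrow> bool" where "sval s = fst s"
definition lpoint :: "sym \<Rightarrow> cell option" where "lpoint s = fst (snd s)"
definition rpoint :: "sym \<Rightarrow> cell option" where "rpoint s = fst (snd (snd s))"
definition bpoint :: "sym \<Rightarrow> nat option" where "bpoint s = snd (snd (snd s))"

definition valid_sym :: "nat \<Rightarrow> nat \<Rightarrow> sym \<Rightarrow> bool" where
  "valid_sym n m s \<longleftrightarrow>
     (\<forall>c. lpoint s = Some c \<longrightarrow> c \<in> cells n m) \<and>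
     (\<forall>c. rpoint s = Some c \<longrightarrow> c \<in> cells n m) \<and>
     (\<forall>j. bpoint s = Some j \<longrightarrow> j \<in> {1..m})"

text \<open>Inputs x \<in> Sigma^M (values outside M are irrelevant).\<close>
definition valid_input :: "nat \<Rightarrow> nat \<Rightarrow> (cell \<Rightarrow> sym) \<Rightarrow> bool" where
  "valid_input n m x \<longleftrightarrow> (\<forall>c \<in> cells n m. valid_sym n m (x c))"

text \<open>The tree T: k = floor(log2 m); r = m - 2^k leftmost leaves of the complete tree with
  2^k leaves get two children. Directions: False = left, True = right.
  The first 2r leaves (from the left) have depth k+1, the remaining ones depth k.\<close>

definition tlog :: "nat \<Rightarrow> nat" where
  "tlog m = (LEAST k. m < 2 ^ (k + 1))"

definition bin_path :: "nat \<Rightarrow> nat \<Rightarrow> bool list" where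
  "bin_path len a = map (\<lambda>i. (a div 2 ^ (len - 1 - i)) mod 2 = 1) [0..<len]"

definition tree_path :: "nat \<Rightarrow> nat \<Rightarrow> bool list" where
  "tree_path m j =
     (let k = tlog m; r = m - 2 ^ k in
      if j \<le> 2 * r then bin_path (k + 1) (j - 1) else bin_path k (j - r - 1))"

fun follow :: "(cell \<Rightarrow> sym) \<Rightarrow> cell \<Rightarrow> bool list \<Rightarrow> cell option" where
  "follow x a [] = Some a"
| "follow x a (d # ds) =
     (case (if d then rpoint (x a) else lpoint (x a)) of
        None \<Rightarrow> None
      | Some a' \<Rightarrow> follow x a' ds)"

definition all_ones_col :: "nat \<Rightarrow> (cell \<Rightarrow> sym) \<Rightarrow> nat \<Rightarrow> bool" where
  "all_ones_col n x b \<longleftrightarrow> (\<forall>i \<in> {1..n}. sval (x (i, b)))"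

definition f_nm :: "nat \<Rightarrow> nat \<Rightarrow> (cell \<Rightarrow> sym) \<Rightarrow> bool" where
  "f_nm n m x \<longleftrightarrow>
     (\<exists>!b. b \<in> {1..m} \<and> all_ones_col n x b) \<and>
     (\<forall>b. b \<in> {1..m} \<and> all_ones_col n x b \<longrightarrow>
        (\<exists>!a. a \<in> {1..n} \<times> {b} \<and> x a \<noteq> (True, None, None, None)) \<and>
        (\<forall>a. a \<in> {1..n} \<times> {b} \<and> x a \<noteq> (True, None, None, None) \<longrightarrow>
           (\<forall>j \<in> {1..m} - {b}. \<exists>l. follow x a (tree_path m j) = Some l \<and>
               snd l = j \<and> \<not> sval (x l) \<and> bpoint (x l) = Some b)))"

definition enc_cell :: "nat \<Rightarrow> cell option \<Rightarrow> nat" where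
  "enc_cell m c = (case c of None \<Rightarrow> 0 | Some (i, j) \<Rightarrow> (i - 1) * m + j)"

definition enc_col :: "nat option \<Rightarrow> nat" where
  "enc_col c = (case c of None \<Rightarrow> 0 | Some j \<Rightarrow> j)"

definition sigma_size :: "nat \<Rightarrow> nat \<Rightarrow> nat" where
  "sigma_size n m = 2 * (n * m + 1) * (n * m + 1) * (m + 1)"

definition enc_sym :: "nat \<Rightarrow> nat \<Rightarrow> sym \<Rightarrow> nat" where
  "enc_sym n m s = (if sval s then 1 else 0) + 2 * (enc_cell m (lpoint s)
      + (n * m + 1) * (enc_cell m (rpoint s) + (n * m + 1) * enc_col (bpoint s)))"

text \<open>The state space has orthonormal basis |c,p,w> with c \<in> M, p \<in> {0..<|Sigma|} and
  w \<in> {0..<W} (workspace); the basis vector |c,p,w> has index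
  ((cellno c) * |Sigma| + p) * W + w, where cellno (i,j) = (i-1)*m + (j-1).
  States are vectors nat \<Rightarrow> complex supported on {0..<D}.\<close>

definition qdim :: "nat \<Rightarrow> nat \<Rightarrow> nat \<Rightarrow> nat" where
  "qdim n m W = n * m * sigma_size n m * W"

definition unitary_mat :: "nat \<Rightarrow> (nat \<Rightarrow> nat \<Rightarrow> complex) \<Rightarrow> bool" where
  "unitary_mat D U \<longleftrightarrow>
     (\<forall>i<D. \<forall>j<D. (\<Sum>k<D. U i k * cnj (U j k)) = (if i = j then 1 else 0))"

definition apply_mat :: "nat \<Rightarrow> (nat \<Rightarrow> nat \<Rightarrow> complex) \<Rightarrow> (nat \<Rightarrow> complex) \<Rightarrow> nat \<Rightarrow> complex" where
  "apply_mat D U v = (\<lambda>i. if i < D then (\<Sum>k<D. U i k * v k) else 0)"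

text \<open>The oracle O_x |c,p,w> = |c, p + x_c mod |Sigma|, w>.\<close>
definition oracle_apply :: "nat \<Rightarrow> nat \<Rightarrow> nat \<Rightarrow> (cell \<Rightarrow> sym) \<Rightarrow> (nat \<Rightarrow> complex) \<Rightarrow> nat \<Rightarrow> complex" where
  "oracle_apply n m W x v = (\<lambda>idx.
     if idx < qdim n m W then
       (let S = sigma_size n m; w = idx mod W; p = (idx div W) mod S; cn = idx div (W * S);
            c = (cn div m + 1, cn mod m + 1); e = enc_sym n m (x c) mod S
        in v ((cn * S + (p + S - e) mod S) * W + w))
     else 0)"

fun run_alg :: "nat \<Rightarrow> nat \<Rightarrow> nat \<Rightarrow> (cell \<Rightarrow> sym) \<Rightarrow> (nat \<Rightarrow> nat \<Rightarrow> complex) list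
                 \<Rightarrow> (nat \<Rightarrow> complex) \<Rightarrow> nat \<Rightarrow> complex" where
  "run_alg n m W x [] v = v"
| "run_alg n m W x [U] v = apply_mat (qdim n m W) U v"
| "run_alg n m W x (U # U' # Us) v =
     run_alg n m W x (U' # Us) (oracle_apply n m W x (apply_mat (qdim n m W) U v))"

definition init_state :: "nat \<Rightarrow> complex" where
  "init_state = (\<lambda>i. if i = 0 then 1 else 0)"

definition success_prob :: "nat \<Rightarrow> nat \<Rightarrow> nat \<Rightarrow> (nat \<Rightarrow> nat \<Rightarrow> complex) list
      \<Rightarrow> (nat \<Rightarrow> bool) \<Rightarrow> (cell \<Rightarrow> sym) \<Rightarrow> bool \<Rightarrow> real" where
  "success_prob n m W Us out x b =
     (\<Sum>i\<in>{i. i < qdim n m W \<and> out i = b}. (cmod (run_alg n m W x Us init_state i))\<^sup>2)"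

definition computes_with_queries ::
  "nat \<Rightarrow> nat \<Rightarrow> ((cell \<Rightarrow> sym) \<Rightarrow> bool) \<Rightarrow> nat \<Rightarrow> bool" where
  "computes_with_queries n m F T \<longleftrightarrow>
     (\<exists>W Us out. W > 0 \<and> length Us = T + 1 \<and>
        (\<forall>U \<in> set Us. unitary_mat (qdim n m W) U) \<and>
        (\<forall>x. valid_input n m x \<longrightarrow> success_prob n m W Us out x (F x) \<ge> 9 / 10))"

definition Q_query :: "nat \<Rightarrow> nat \<Rightarrow> ((cell \<Rightarrow> sym) \<Rightarrow> bool) \<Rightarrow> nat" where
  "Q_query n m F = (LEAST T. computes_with_queries n m F T)"

end

theory Submission
  imports Defs "HOL-Analysis.L2_Norm"
begin

text \<open>
  Everything happens in the dual of the general adversary bound. For a positive input \<open>x\<close> with marked column \<open>b\<close> and a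
  negative input \<open>y\<close>, a classical walk on columns is made coherent: from column \<open>j\<close> stop with weight \<open>1\<close>, or move to
  \<open>bpoint\<close> of a zero cell with weight \<open>1 / w\<close>, where \<open>w - 1\<close> is the number of zeros of the column pointed to. Columns with
  few zeros are preferred, so the walk stops after \<open>O(log n)\<close> steps on average, and it stops at columns whose zero cells
  point to columns \<open>b'\<close> with small \<open>\<Sum> 1 / w\<close>. There the leaf of \<open>x\<close> points to \<open>b\<close>, and refuting the candidate columns
  \<open>b'\<close> costs \<open>sqrt n / w\<close> each by quantum search, which adds up to \<open>O(sqrt n)\<close>; checking the tree in \<open>b\<close> costs
  \<open>sqrt m\<close> up to a logarithm. The normalisation of the walk uses that the Cauchy kernel \<open>1 / (p x + p y)\<close> is an explicit
  Gram matrix.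

  A dual solution of cost \<open>L\<close> gives an algorithm with \<open>O(L)\<close> queries: its vectors form a catalyst whose Gram matrix changes
  under the oracle by a multiple of \<open>[f x \<noteq> f y]\<close>, so that equal Gram matrices provide the unitaries (products of
  Householder reflections), and leaving the catalyst out of the start state costs an error of \<open>sqrt (L / K)\<close> after
  \<open>K\<close> queries.
\<close>

text \<open>The obstacle is that the transition weights and the normalisation of the walk depend on
  the input, while a dual solution must factor into a vector for \<open>x\<close> and a vector for
  \<open>y\<close>, whose walks differ. Every such quantity is therefore replaced by a symmetric
  one, \<open>2 / (w x + w y)\<close>, which has the right value when both inputs agree on it and is
  a Gram matrix with squared norms \<open>1 / w x\<close> and \<open>1 / w y\<close>. The defect of
  this replacement is proportional to \<open>(w x - w y)\<^sup>2\<close>; a difference of counts is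
  a sum over cells on which the inputs differ, so it can be paid for by queries. Costs are kept as
  functions of the input. A composition then averages the costs along the walk of one and the same
  input, where a worst case over columns would lose the factor \<open>1 / w\<close>. Kernels are
  exact, so nesting many steps needs no error reduction, and the number of steps enters the cost
  only through its mean. The constant 400 is \<open>20\<^sup>2\<close>: omitting the catalyst then
  displaces the final state by at most 1/20, and \<open>(19/20)\<^sup>2\<close> is still above
  9/10.\<close>

section \<open>Adversary kernels\<close>

text \<open>Points are added one at a time. Subtracting the rank-one term
  \<open>2 * s / ((a + s) * (b + s))\<close> from the Cauchy kernel leaves the kernel itself times
  \<open>h a * h b\<close>, where \<open>h\<close> is the Blaschke factor vanishing at
  \<open>s\<close>. On the diagonal the squares of the \<open>g i a\<close> sum to
  \<open>1 / (2 * a)\<close>.\<close>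

lemma cauchy_gram:
  fixes S :: "real set"
  assumes "finite S" "\<And>a. a \<in> S \<Longrightarrow> a > 0"
  shows "\<exists>(N::nat) g. \<forall>a\<in>S. \<forall>b\<in>S. 1 / (a + b) = (\<Sum>i<N. g i a * g i b)"
  using assms
proof (induction S rule: finite_induct)
  case empty
  show ?case by simp
next
  case (insert s S)
  then obtain N :: nat and g where g: "\<And>a b. a \<in> S \<Longrightarrow> b \<in> S \<Longrightarrow> 1 / (a + b) = (\<Sum>i<N. g i a * g i b)"
    by auto
  have s: "s > 0" and pos: "\<And>a. a \<in> S \<Longrightarrow> a > 0" using insert by auto
  define h where "h a = (a - s) / (a + s)" for a
  define g' where "g' i a = (case i of 0 \<Rightarrow> sqrt (2 * s) / (a + s) | Suc i \<Rightarrow> h a * g i a)" for i :: nat and a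
  have split: "1 / (a + b) = 2 * s / ((a + s) * (b + s)) + h a * h b * (1 / (a + b))"
    if "a > 0" "b > 0" for a b
  proof -
    have nz: "a + b \<noteq> 0" "a + s \<noteq> 0" "b + s \<noteq> 0" using that s by auto
    have "2 * s / ((a + s) * (b + s)) + h a * h b * (1 / (a + b))
        = (2 * s * (a + b) + (a - s) * (b - s)) / ((a + s) * (b + s) * (a + b))"
      unfolding h_def using nz by (simp add: divide_simps)
    also have "2 * s * (a + b) + (a - s) * (b - s) = (a + s) * (b + s)" by algebra
    finally show ?thesis using nz by simp
  qed
  have "1 / (a + b) = (\<Sum>i<Suc N. g' i a * g' i b)" if "a \<in> insert s S" "b \<in> insert s S" for a b
  proof -
    have ab: "a > 0" "b > 0" using that s pos by auto
    have "(\<Sum>i<Suc N. g' i a * g' i b)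
        = sqrt (2 * s) / (a + s) * (sqrt (2 * s) / (b + s)) + (\<Sum>i<N. h a * h b * (g i a * g i b))"
      unfolding sum.lessThan_Suc_shift by (simp add: g'_def mult_ac)
    also have "\<dots> = 2 * s / ((a + s) * (b + s)) + h a * h b * (\<Sum>i<N. g i a * g i b)"
      using s by (simp add: sum_distrib_left)
    \<comment> \<open>The induction hypothesis says nothing at the new point \<open>s\<close>, but
      \<open>h s = 0\<close> removes both sides there.\<close>
    also have "h a * h b * (\<Sum>i<N. g i a * g i b) = h a * h b * (1 / (a + b))"
      using that g by (cases "a = s \<or> b = s") (auto simp: h_def)
    finally show ?thesis using split[OF ab] by simp
  qed
  then show ?case by blast
qed

lemma sum_of_bool_single:
  fixes F :: "'a \<Rightarrow> real"
  assumes "finite S" "a \<in> S"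
  shows "(\<Sum>s\<in>S. of_bool (a = s) * F s) = F a"
proof -
  have "(\<Sum>s\<in>S. of_bool (a = s) * F s) = (\<Sum>s\<in>S. if a = s then F s else 0)"
    by (intro sum.cong) auto
  then show ?thesis using assms by simp
qed

lemma of_bool_square: "(of_bool b :: real)\<^sup>2 = of_bool b"
  by simp

text \<open>\<open>adm K A B\<close>: the kernel \<open>K\<close> on \<open>X \<times> Y\<close> is a sum of query differences with vectors of squared norm at most
  \<open>A\<close> and \<open>B\<close>, i.e. a feasible solution of the dual adversary program with input-dependent cost.\<close>

locale adversary =
  fixes C :: "'c set" and X Y :: "('c \<Rightarrow> 's) set"
  assumes finite_C: "finite C" and finite_X: "finite X" and finite_Y: "finite Y"
begin

definition adm :: "(('c \<Rightarrow> 's) \<Rightarrow> ('c \<Rightarrow> 's) \<Rightarrow> real) \<Rightarrow> (('c \<Rightarrow> 's) \<Rightarrow> real) \<Rightarrow> (('c \<Rightarrow> 's) \<Rightarrow> real) \<Rightarrow> bool" where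
  "adm K A B \<longleftrightarrow> (\<exists>I u v. finite (I :: nat set) \<and>
     (\<forall>x\<in>X. \<forall>y\<in>Y. K x y = (\<Sum>c\<in>C. \<Sum>w\<in>I. if x c = y c then 0 else u x c w * v y c w)) \<and>
     (\<forall>x\<in>X. (\<Sum>c\<in>C. \<Sum>w\<in>I. (u x c w)\<^sup>2) \<le> A x) \<and>
     (\<forall>y\<in>Y. (\<Sum>c\<in>C. \<Sum>w\<in>I. (v y c w)\<^sup>2) \<le> B y))"

text \<open>\<open>adm\<close> fixes natural numbers as indices because its body cannot quantify
  over types; any finite index set is renamed injectively.\<close>

lemma admI:
  fixes I :: "'i set"
  assumes "finite I"
    and "\<And>x y. x \<in> X \<Longrightarrow> y \<in> Y \<Longrightarrow> K x y = (\<Sum>c\<in>C. \<Sum>w\<in>I. if x c = y c then 0 else u x c w * v y c w)"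
    and "\<And>x. x \<in> X \<Longrightarrow> (\<Sum>c\<in>C. \<Sum>w\<in>I. (u x c w)\<^sup>2) \<le> A x"
    and "\<And>y. y \<in> Y \<Longrightarrow> (\<Sum>c\<in>C. \<Sum>w\<in>I. (v y c w)\<^sup>2) \<le> B y"
  shows "adm K A B"
proof -
  obtain g :: "'i \<Rightarrow> nat" where g: "inj_on g I"
    using finite_imp_inj_to_nat_seg[OF assms(1)] by auto
  define g' where "g' = inv_into I g"
  have g': "g' (g i) = i" if "i \<in> I" for i using that g by (simp add: g'_def)
  have "finite (g ` I) \<and>
     (\<forall>x\<in>X. \<forall>y\<in>Y. K x y = (\<Sum>c\<in>C. \<Sum>w\<in>g ` I. if x c = y c then 0 else u x c (g' w) * v y c (g' w))) \<and>
     (\<forall>x\<in>X. (\<Sum>c\<in>C. \<Sum>w\<in>g ` I. (u x c (g' w))\<^sup>2) \<le> A x) \<and>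
     (\<forall>y\<in>Y. (\<Sum>c\<in>C. \<Sum>w\<in>g ` I. (v y c (g' w))\<^sup>2) \<le> B y)"
  proof (intro conjI ballI)
    fix x y assume xy: "x \<in> X" "y \<in> Y"
    show "K x y = (\<Sum>c\<in>C. \<Sum>w\<in>g ` I. if x c = y c then 0 else u x c (g' w) * v y c (g' w))"
      unfolding assms(2)[OF xy] by (rule sum.cong[OF refl], subst sum.reindex[OF g], rule sum.cong[OF refl]) (simp add: g')
  qed (use assms(1,3,4) in \<open>simp_all add: sum.reindex[OF g] g' cong: sum.cong\<close>)
  then show ?thesis unfolding adm_def
    by (intro exI[of _ "g ` I"] exI[of _ "\<lambda>x c w. u x c (g' w)"] exI[of _ "\<lambda>y c w. v y c (g' w)"])
qed

lemma adm_mono: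
  assumes "adm K A B"
    and "\<And>x y. x \<in> X \<Longrightarrow> y \<in> Y \<Longrightarrow> K' x y = K x y"
    and "\<And>x. x \<in> X \<Longrightarrow> A x \<le> A' x" and "\<And>y. y \<in> Y \<Longrightarrow> B y \<le> B' y"
  shows "adm K' A' B'"
proof -
  obtain I u v where *: "finite (I :: nat set)"
    "\<forall>x\<in>X. \<forall>y\<in>Y. K x y = (\<Sum>c\<in>C. \<Sum>w\<in>I. if x c = y c then 0 else u x c w * v y c w)"
    "\<forall>x\<in>X. (\<Sum>c\<in>C. \<Sum>w\<in>I. (u x c w)\<^sup>2) \<le> A x"
    "\<forall>y\<in>Y. (\<Sum>c\<in>C. \<Sum>w\<in>I. (v y c w)\<^sup>2) \<le> B y"
    using assms(1) unfolding adm_def by blast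
  show ?thesis
  proof (rule admI[of I _ u v])
    show "(\<Sum>c\<in>C. \<Sum>w\<in>I. (u x c w)\<^sup>2) \<le> A' x" if "x \<in> X" for x
      using *(3) assms(3) that order.trans by blast
    show "(\<Sum>c\<in>C. \<Sum>w\<in>I. (v y c w)\<^sup>2) \<le> B' y" if "y \<in> Y" for y
      using *(4) assms(4) that order.trans by blast
  qed (use *(1,2) assms(2) in auto)
qed

lemma adm_query:
  assumes "c \<in> C"
  shows "adm (\<lambda>x y. if x c = y c then 0 else 1) (\<lambda>_. 1) (\<lambda>_. 1)"
proof (rule admI[of "{()}" _ "\<lambda>_ c' _. of_bool (c' = c)" "\<lambda>_ c' _. of_bool (c' = c)"])
  fix x y :: "'c \<Rightarrow> 's"
  have "(\<Sum>c'\<in>C. \<Sum>w\<in>{()}. if x c' = y c' then 0 else of_bool (c' = c) * of_bool (c' = c))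
      = (\<Sum>c'\<in>C. if c' = c then (if x c = y c then 0 else 1) else (0 :: real))"
    by (intro sum.cong) auto
  then show "(if x c = y c then 0 else 1) = (\<Sum>c'\<in>C. \<Sum>w\<in>{()}. if x c' = y c' then 0
      else of_bool (c' = c) * of_bool (c' = c) :: real)"
    using assms finite_C by simp
qed (use assms finite_C in \<open>simp_all add: of_bool_def if_distrib[of "\<lambda>t. t ^ 2"] cong: if_cong\<close>)

text \<open>The vectors for different \<open>e\<close> occupy orthogonal blocks and are scaled by
  \<open>\<alpha>\<close> and \<open>\<beta>\<close>, so costs add up with squared weights.\<close>

lemma adm_sum:
  fixes E :: "'e set"
  assumes E: "finite E" and adm: "\<And>e. e \<in> E \<Longrightarrow> adm (K e) (A e) (B e)"
  shows "adm (\<lambda>x y. \<Sum>e\<in>E. \<alpha> e x * \<beta> e y * K e x y)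
             (\<lambda>x. \<Sum>e\<in>E. (\<alpha> e x)\<^sup>2 * A e x) (\<lambda>y. \<Sum>e\<in>E. (\<beta> e y)\<^sup>2 * B e y)"
proof -
  have "\<forall>e\<in>E. \<exists>I u v. finite (I :: nat set) \<and>
     (\<forall>x\<in>X. \<forall>y\<in>Y. K e x y = (\<Sum>c\<in>C. \<Sum>w\<in>I. if x c = y c then 0 else u x c w * v y c w)) \<and>
     (\<forall>x\<in>X. (\<Sum>c\<in>C. \<Sum>w\<in>I. (u x c w)\<^sup>2) \<le> A e x) \<and>
     (\<forall>y\<in>Y. (\<Sum>c\<in>C. \<Sum>w\<in>I. (v y c w)\<^sup>2) \<le> B e y)"
    using adm unfolding adm_def by blast
  then obtain I u v where *: "\<forall>e\<in>E. finite (I e :: nat set) \<and>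
     (\<forall>x\<in>X. \<forall>y\<in>Y. K e x y = (\<Sum>c\<in>C. \<Sum>w\<in>I e. if x c = y c then 0 else u e x c w * v e y c w)) \<and>
     (\<forall>x\<in>X. (\<Sum>c\<in>C. \<Sum>w\<in>I e. (u e x c w)\<^sup>2) \<le> A e x) \<and>
     (\<forall>y\<in>Y. (\<Sum>c\<in>C. \<Sum>w\<in>I e. (v e y c w)\<^sup>2) \<le> B e y)"
    unfolding bchoice_iff by blast
  have sw: "(\<Sum>c\<in>C. \<Sum>w\<in>Sigma E I. F c (fst w) (snd w)) = (\<Sum>e\<in>E. \<Sum>c\<in>C. \<Sum>w\<in>I e. F c e w)"
    for F :: "'c \<Rightarrow> 'e \<Rightarrow> nat \<Rightarrow> real"
  proof -
    have "(\<Sum>w\<in>Sigma E I. F c (fst w) (snd w)) = (\<Sum>e\<in>E. \<Sum>w\<in>I e. F c e w)" for c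
      using E * by (subst sum.Sigma) (auto simp: case_prod_unfold)
    then show ?thesis using sum.swap by simp
  qed
  show ?thesis
  proof (rule admI[of "Sigma E I" _ "\<lambda>x c w. \<alpha> (fst w) x * u (fst w) x c (snd w)"
        "\<lambda>y c w. \<beta> (fst w) y * v (fst w) y c (snd w)"])
    show "finite (Sigma E I)" using E * by auto
  next
    fix x y assume "x \<in> X" "y \<in> Y"
    then have "K e x y = (\<Sum>c\<in>C. \<Sum>w\<in>I e. if x c = y c then 0 else u e x c w * v e y c w)" if "e \<in> E" for e
      using * that by blast
    then show "(\<Sum>e\<in>E. \<alpha> e x * \<beta> e y * K e x y) = (\<Sum>c\<in>C. \<Sum>w\<in>Sigma E I. if x c = y c then 0
        else (\<alpha> (fst w) x * u (fst w) x c (snd w)) * (\<beta> (fst w) y * v (fst w) y c (snd w)))"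
      by (subst sw) (auto simp: sum_distrib_left intro!: sum.cong)
  next
    fix x assume "x \<in> X"
    then have "(\<Sum>c\<in>C. \<Sum>w\<in>I e. (u e x c w)\<^sup>2) \<le> A e x" if "e \<in> E" for e
      using * that by blast
    then show "(\<Sum>c\<in>C. \<Sum>w\<in>Sigma E I. (\<alpha> (fst w) x * u (fst w) x c (snd w))\<^sup>2) \<le> (\<Sum>e\<in>E. (\<alpha> e x)\<^sup>2 * A e x)"
      by (subst sw) (auto simp: power_mult_distrib simp flip: sum_distrib_left intro!: sum_mono mult_left_mono)
  next
    fix y assume "y \<in> Y"
    then have "(\<Sum>c\<in>C. \<Sum>w\<in>I e. (v e y c w)\<^sup>2) \<le> B e y" if "e \<in> E" for e
      using * that by blast
    then show "(\<Sum>c\<in>C. \<Sum>w\<in>Sigma E I. (\<beta> (fst w) y * v (fst w) y c (snd w))\<^sup>2) \<le> (\<Sum>e\<in>E. (\<beta> e y)\<^sup>2 * B e y)"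
      by (subst sw) (auto simp: power_mult_distrib simp flip: sum_distrib_left intro!: sum_mono mult_left_mono)
  qed
qed

lemma adm_mult:
  assumes "adm K A B"
  shows "adm (\<lambda>x y. \<alpha> x * \<beta> y * K x y) (\<lambda>x. (\<alpha> x)\<^sup>2 * A x) (\<lambda>y. (\<beta> y)\<^sup>2 * B y)"
  using adm_sum[of "{()}" "\<lambda>_. K" "\<lambda>_. A" "\<lambda>_. B" "\<lambda>_. \<alpha>" "\<lambda>_. \<beta>"] assms by simp

text \<open>Moves cost between the two sides. It is what turns a pair of costs \<open>1\<close> and
  \<open>n\<close> into \<open>sqrt n\<close> for both, the gain of quantum search.\<close>

lemma adm_rescale:
  assumes "adm K A B" "s > 0"
  shows "adm K (\<lambda>x. s * A x) (\<lambda>y. B y / s)"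
  by (rule adm_mono[OF adm_mult[OF assms(1), of "\<lambda>_. sqrt s" "\<lambda>_. 1 / sqrt s"]])
     (use assms(2) in \<open>auto simp: power_divide\<close>)

lemma adm_add:
  assumes "adm K A B" "adm K' A' B'"
  shows "adm (\<lambda>x y. K x y + K' x y) (\<lambda>x. A x + A' x) (\<lambda>y. B y + B' y)"
proof -
  have "adm (\<lambda>x y. \<Sum>b\<in>{True, False}. 1 * 1 * (if b then K else K') x y)
     (\<lambda>x. \<Sum>b\<in>{True, False}. 1\<^sup>2 * (if b then A else A') x)
     (\<lambda>y. \<Sum>b\<in>{True, False}. 1\<^sup>2 * (if b then B else B') y)"
    by (rule adm_sum) (use assms in auto)
  then show ?thesis by simp
qed

text \<open>Once \<open>x\<close> and \<open>y\<close> are known to share the value of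
  \<open>g\<close>, the kernel may depend on it. The blocks for different values are orthogonal, so
  each input pays only for its own branch, not for the sum or maximum over branches.\<close>

lemma adm_cond:
  assumes "\<And>s. s \<in> g ` (X \<union> Y) \<Longrightarrow> adm (K s) (A s) (B s)"
  shows "adm (\<lambda>x y. if g x = g y then K (g x) x y else 0) (\<lambda>x. A (g x) x) (\<lambda>y. B (g y) y)"
proof -
  have fin: "finite (g ` (X \<union> Y))" using finite_X finite_Y by simp
  show ?thesis
  proof (rule adm_mono[OF adm_sum[where \<alpha> = "\<lambda>s x. of_bool (g x = s)" and \<beta> = "\<lambda>s x. of_bool (g x = s)", OF fin assms]])
    fix x y assume xy: "x \<in> X" "y \<in> Y"
    then have "(\<Sum>s\<in>g ` (X \<union> Y). of_bool (g x = s) * of_bool (g y = s) * K s x y)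
        = of_bool (g y = g x) * K (g x) x y"
      using sum_of_bool_single[OF fin, of "g x" "\<lambda>s. of_bool (g y = s) * K s x y"] by (simp add: mult.assoc)
    then show "(if g x = g y then K (g x) x y else 0)
        = (\<Sum>s\<in>g ` (X \<union> Y). of_bool (g x = s) * of_bool (g y = s) * K s x y)"
      by auto
  qed (use sum_of_bool_single[OF fin] in \<open>auto simp: of_bool_square\<close>)
qed

text \<open>Division by the mean of \<open>p x\<close> and \<open>p y\<close>. The Gram vectors of
  \<open>2 / (p x + p y)\<close> have squared norm \<open>1 / p\<close>, so both costs are divided
  by the value of \<open>p\<close> at their own input. Finiteness of the input sets makes
  \<open>cauchy_gram\<close> applicable.\<close>

lemma adm_cauchy:
  assumes "adm K A B" and p: "\<And>x. x \<in> X \<union> Y \<Longrightarrow> p x > 0"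
  shows "adm (\<lambda>x y. 2 * K x y / (p x + p y)) (\<lambda>x. A x / p x) (\<lambda>y. B y / p y)"
proof -
  obtain N :: nat and g where g: "\<forall>a\<in>p ` (X \<union> Y). \<forall>b\<in>p ` (X \<union> Y). 1 / (a + b) = (\<Sum>i<N. g i a * g i b)"
    using cauchy_gram[of "p ` (X \<union> Y)"] finite_X finite_Y p by blast
  then have g: "1 / (p x + p y) = (\<Sum>i<N. g i (p x) * g i (p y))" if "x \<in> X \<union> Y" "y \<in> X \<union> Y" for x y
    using that by blast
  have sq: "2 * (\<Sum>i<N. (g i (p x))\<^sup>2) = 1 / p x" if "x \<in> X \<union> Y" for x
    using g[of x x] p[of x] that by (simp add: power2_eq_square)
  have "adm (\<lambda>x y. \<Sum>i<N. (sqrt 2 * g i (p x)) * (sqrt 2 * g i (p y)) * K x y)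
     (\<lambda>x. \<Sum>i<N. (sqrt 2 * g i (p x))\<^sup>2 * A x) (\<lambda>y. \<Sum>i<N. (sqrt 2 * g i (p y))\<^sup>2 * B y)"
    by (rule adm_sum) (use assms in auto)
  then show ?thesis
  proof (rule adm_mono)
    fix x y assume xy: "x \<in> X" "y \<in> Y"
    have "2 * K x y / (p x + p y) = 2 * (1 / (p x + p y)) * K x y" by simp
    also have "\<dots> = 2 * (\<Sum>i<N. g i (p x) * g i (p y)) * K x y" using g xy by simp
    also have "\<dots> = (\<Sum>i<N. (sqrt 2 * g i (p x)) * (sqrt 2 * g i (p y)) * K x y)"
      unfolding sum_distrib_left sum_distrib_right by (intro sum.cong) auto
    finally show "2 * K x y / (p x + p y) = (\<Sum>i<N. (sqrt 2 * g i (p x)) * (sqrt 2 * g i (p y)) * K x y)" .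
  next
    fix x assume "x \<in> X"
    have "(\<Sum>i<N. (sqrt 2 * g i (p x))\<^sup>2 * A x) = 2 * (\<Sum>i<N. (g i (p x))\<^sup>2) * A x"
      unfolding sum_distrib_left sum_distrib_right by (intro sum.cong) (auto simp: power_mult_distrib)
    then show "(\<Sum>i<N. (sqrt 2 * g i (p x))\<^sup>2 * A x) \<le> A x / p x"
      using sq[of x] \<open>x \<in> X\<close> by simp
  next
    fix x assume "x \<in> Y"
    have "(\<Sum>i<N. (sqrt 2 * g i (p x))\<^sup>2 * B x) = 2 * (\<Sum>i<N. (g i (p x))\<^sup>2) * B x"
      unfolding sum_distrib_left sum_distrib_right by (intro sum.cong) (auto simp: power_mult_distrib)
    then show "(\<Sum>i<N. (sqrt 2 * g i (p x))\<^sup>2 * B x) \<le> B x / p x"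
      using sq[of x] \<open>x \<in> Y\<close> by simp
  qed
qed

text \<open>At a cell that is counted on the left the symbols of \<open>x\<close> and
  \<open>y\<close> differ, so the query kernel is 1 there.\<close>

lemma adm_count_diff:
  assumes R: "R \<subseteq> C"
  shows "adm (\<lambda>x y. \<Sum>c\<in>R. of_bool (P (x c) \<and> \<not> P (y c)))
           (\<lambda>x. \<Sum>c\<in>R. of_bool (P (x c))) (\<lambda>y. \<Sum>c\<in>R. of_bool (\<not> P (y c)))"
proof -
  have fin: "finite R" using R finite_C finite_subset by blast
  have "adm (\<lambda>x y. \<Sum>c\<in>R. of_bool (P (x c)) * of_bool (\<not> P (y c)) * (if x c = y c then 0 else 1))
           (\<lambda>x. \<Sum>c\<in>R. (of_bool (P (x c)))\<^sup>2 * 1) (\<lambda>y. \<Sum>c\<in>R. (of_bool (\<not> P (y c)))\<^sup>2 * 1)"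
    by (rule adm_sum[OF fin]) (use adm_query R in auto)
  then show ?thesis
    by (rule adm_mono) (auto intro!: sum.cong sum_mono)
qed

text \<open>The kernel is twice the failure of \<open>2 / (w x + w y)\<close> to equal the mean of its diagonal values \<open>1 / w x\<close>, \<open>1 / w y\<close>:
  it pays for replacing the unknown count by a state that depends on it smoothly.\<close>

lemma adm_inverse_count:
  assumes R: "R \<subseteq> C" and N: "real (card R) \<le> N" "N > 0"
    and w: "\<And>x. w x = 1 + (\<Sum>c\<in>R. of_bool (P (x c)))"
  shows "adm (\<lambda>x y. 1 / w x + 1 / w y - 4 / (w x + w y)) (\<lambda>x. 4 * sqrt N / w x) (\<lambda>y. 4 * sqrt N / w y)"
proof -
  define z where "z x = (\<Sum>c\<in>R. of_bool (P (x c)) :: real)" for x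
  have z0: "z x \<ge> 0" for x by (simp add: z_def sum_nonneg)
  have wz: "w x = 1 + z x" for x by (simp add: w z_def)
  have w1: "w x \<ge> 1" for x using z0 wz by simp
  have w0: "w x > 0" for x using w1[of x] by simp
  have zw: "z x \<le> w x" for x using wz by simp
  define D where "D x y = (\<Sum>c\<in>R. of_bool (P (x c) \<and> \<not> P (y c)) :: real)" for x y
  define D' where "D' x y = (\<Sum>c\<in>R. of_bool (\<not> P (x c) \<and> P (y c)) :: real)" for x y
  have diff: "D x y - D' x y = w x - w y" for x y
    unfolding D_def D'_def w by (auto simp flip: sum_subtractf intro!: sum.cong)
  have sN: "sqrt N > 0" and sN2: "N = sqrt N * sqrt N" using N by auto
  have negN: "(\<Sum>c\<in>R. of_bool (\<not> P (x c)) :: real) \<le> N" for x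
  proof -
    have "(\<Sum>c\<in>R. of_bool (\<not> P (x c)) :: real) \<le> (\<Sum>c\<in>R. 1)" by (rule sum_mono) auto
    then show ?thesis using N by simp
  qed
  have a1: "adm D z (\<lambda>_. N)"
    by (rule adm_mono[OF adm_count_diff[OF R, of P]]) (use negN in \<open>auto simp: D_def z_def\<close>)
  have a2: "adm D' (\<lambda>_. N) z"
    by (rule adm_mono[OF adm_count_diff[OF R, of "\<lambda>s. \<not> P s"]]) (use negN in \<open>auto simp: D'_def z_def\<close>)
  have b1: "z x / (w x)\<^sup>2 \<le> 1 / w x" for x
    using zw[of x] w0[of x] by (simp add: power2_eq_square field_simps)
  have b2: "z x / (w x * (w x)\<^sup>2) \<le> 1 / w x" for x
  proof -
    have "z x / (w x * (w x)\<^sup>2) = z x / (w x)\<^sup>2 * (1 / w x)" by simp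
    also have "\<dots> \<le> 1 / w x * 1" using b1[of x] w1[of x] w0[of x] z0 by (intro mult_mono) auto
    finally show ?thesis by simp
  qed
  have b3: "1 / (w x)\<^sup>2 \<le> 1 / w x" for x
    using w1[of x] by (simp add: power2_eq_square field_simps)
  have s1: "sqrt N * t \<le> sqrt N / w x" if "t \<le> 1 / w x" for t x
    using mult_left_mono[OF that, of "sqrt N"] sN by simp
  have s2: "t * N / sqrt N \<le> sqrt N / w x" if "t \<le> 1 / w x" for t x
  proof -
    have "t * N / sqrt N = sqrt N * t" using sN sN2 by (metis mult.commute nonzero_mult_div_cancel_left mult.assoc less_numeral_extra(3))
    then show ?thesis using s1[OF that] by simp
  qed
  have s1': "sqrt N * (z x / (w x)\<^sup>2) \<le> sqrt N / w x" "sqrt N * (z x / (w x * (w x)\<^sup>2)) \<le> sqrt N / w x"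
    "N / (w x)\<^sup>2 / sqrt N \<le> sqrt N / w x" "N / w x / sqrt N \<le> sqrt N / w x" for x
    using s1[OF b1] s1[OF b2] s2[OF b3] s2[of "1 / w x" x] by simp_all
  have t1: "adm (\<lambda>x y. 1 / w x * (1 / w y) * D x y) (\<lambda>x. sqrt N / w x) (\<lambda>y. sqrt N / w y)"
    by (rule adm_mono[OF adm_rescale[OF adm_mult[OF a1, of "\<lambda>x. 1 / w x" "\<lambda>y. 1 / w y"] sN]])
       (use s1'(1,3) in \<open>simp_all add: power_divide\<close>)
  have t2: "adm (\<lambda>x y. 1 / w x * (1 / w y) * D' x y) (\<lambda>x. sqrt N / w x) (\<lambda>y. sqrt N / w y)"
    by (rule adm_mono[OF adm_rescale[OF adm_mult[OF a2, of "\<lambda>x. 1 / w x" "\<lambda>y. 1 / w y"], of "1 / sqrt N"]])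
       (use s1'(1,3) sN in \<open>simp_all add: power_divide mult.commute\<close>)
  \<comment> \<open>In \<open>(w x - w y)\<^sup>2 / (w x * w y * (w x + w y))\<close> one factor of
    the square becomes \<open>D - D'\<close>; the rest is split into partial fractions. In the terms
    with \<open>w x + w y\<close> the extra \<open>1 / w\<close> is put on the side whose cost is
    the count \<open>z\<close>, where \<open>z / w ^ 3 \<le> 1 / w\<close>; the side with cost
    \<open>N\<close> gets its \<open>1 / w\<close> from \<open>adm_cauchy\<close>.\<close>
  have t3: "adm (\<lambda>x y. 2 * (- 1 / w x * 1 * D x y) / (w x + w y)) (\<lambda>x. sqrt N / w x) (\<lambda>y. sqrt N / w y)"
    by (rule adm_mono[OF adm_rescale[OF adm_cauchy[OF adm_mult[OF a1, of "\<lambda>x. - 1 / w x" "\<lambda>y. 1"], of w] sN]])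
       (use s1'(2,4) w0 in \<open>simp_all add: power_divide mult.commute\<close>)
  have t4: "adm (\<lambda>x y. 2 * (1 * (- 1 / w y) * D' x y) / (w x + w y)) (\<lambda>x. sqrt N / w x) (\<lambda>y. sqrt N / w y)"
    by (rule adm_mono[OF adm_rescale[OF adm_cauchy[OF adm_mult[OF a2, of "\<lambda>x. 1" "\<lambda>y. - 1 / w y"], of w], of "1 / sqrt N"]])
       (use s1'(2,4) w0 sN in \<open>simp_all add: power_divide mult.commute\<close>)
  show ?thesis
  proof (rule adm_mono[OF adm_add[OF adm_add[OF t1 t3] adm_add[OF t2 t4]]])
    fix x y
    have nz: "w x \<noteq> 0" "w y \<noteq> 0" "w x + w y \<noteq> 0" using w0[of x] w0[of y] by auto
    have "1 / w x + 1 / w y - 4 / (w x + w y) = (w x - w y) * (w x - w y) / (w x * w y * (w x + w y))"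
      using nz by (simp add: divide_simps) (simp add: algebra_simps)
    also have "\<dots> = (D x y - D' x y) * (w x - w y) / (w x * w y * (w x + w y))" by (simp add: diff)
    also have "\<dots> = 1 / w x * (1 / w y) * D x y + 2 * (- 1 / w x * 1 * D x y) / (w x + w y) +
       (1 / w x * (1 / w y) * D' x y + 2 * (1 * (- 1 / w y) * D' x y) / (w x + w y))"
      using nz by (simp add: divide_simps) (simp add: algebra_simps)
    finally show "1 / w x + 1 / w y - 4 / (w x + w y) = \<dots>" .
  qed auto
qed

end

section \<open>Certificates on the grid\<close>

lemma sum_single:
  assumes "finite E" "a \<in> E" "\<And>c. c \<in> E \<Longrightarrow> c \<noteq> a \<Longrightarrow> F c = (0 :: real)"
  shows "sum F E = F a"
  using assms by (subst sum.remove[of E a]) (auto intro!: sum.neutral)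

lemma sum_of_bool_le_1:
  assumes "finite E" "\<And>c d. c \<in> E \<Longrightarrow> d \<in> E \<Longrightarrow> P c \<Longrightarrow> P d \<Longrightarrow> c = d"
  shows "(\<Sum>c\<in>E. of_bool (P c)) \<le> (1 :: real)"
proof (cases "\<exists>a\<in>E. P a")
  case True
  then obtain a where a: "a \<in> E" "P a" by auto
  have "(\<Sum>c\<in>E. of_bool (P c)) = (of_bool (P a) :: real)"
    using assms(2)[OF _ a(1) _ a(2)] by (intro sum_single[OF assms(1) a(1)]) auto
  then show ?thesis by simp
next
  case False
  then have "(\<Sum>c\<in>E. of_bool (P c)) = (0 :: real)" by (intro sum.neutral) auto
  then show ?thesis by simp
qed

lemma sum_of_bool_le_card: "(\<Sum>c\<in>E. of_bool (P c)) \<le> real (card E)"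
  using sum_mono[of E "\<lambda>c. of_bool (P c)" "\<lambda>_. 1 :: real"] by simp

context adversary
begin

lemma adm_zero: "adm (\<lambda>_ _. 0) (\<lambda>_. 0) (\<lambda>_. 0)"
  by (rule admI[of "{} :: nat set" _ "\<lambda>_ _ _. 0" "\<lambda>_ _ _. 0"]) auto

lemma adm_sum_bool:
  fixes E :: "'e set"
  assumes "finite E" "\<And>e. e \<in> E \<Longrightarrow> adm (K e) (\<lambda>_. a) (\<lambda>_. b)" "a \<ge> 0" "b \<ge> 0"
    and "\<And>x. x \<in> X \<Longrightarrow> (\<Sum>e\<in>E. of_bool (\<alpha> e x)) \<le> a'"
    and "\<And>y. y \<in> Y \<Longrightarrow> (\<Sum>e\<in>E. of_bool (\<beta> e y)) \<le> b' y"
    and "\<And>x y. x \<in> X \<Longrightarrow> y \<in> Y \<Longrightarrow> K' x y = (\<Sum>e\<in>E. of_bool (\<alpha> e x) * of_bool (\<beta> e y) * K e x y)"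
  shows "adm K' (\<lambda>_. a' * a) (\<lambda>y. b' y * b)"
  by (rule adm_mono[OF adm_sum[where \<alpha> = "\<lambda>e x. of_bool (\<alpha> e x)" and \<beta> = "\<lambda>e x. of_bool (\<beta> e x)", OF assms(1,2)]])
     (use assms(3-) in \<open>auto simp: of_bool_square mult_right_mono simp flip: sum_distrib_right\<close>)

end

section \<open>Inputs, certificates for value 1, and the weights of the walk\<close>

abbreviation triv :: sym where "triv \<equiv> (True, None, None, None)"

text \<open>Symbols off the grid are frozen so that the set of inputs is finite, as the locale
  \<open>adversary\<close> demands.\<close>

definition inputs :: "nat \<Rightarrow> nat \<Rightarrow> (cell \<Rightarrow> sym) set" where
  "inputs n m = {x. valid_input n m x \<and> (\<forall>c. c \<notin> cells n m \<longrightarrow> x c = triv)}"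

lemma finite_valid_sym: "finite {s. valid_sym n m s}"
proof -
  have "{s. valid_sym n m s} \<subseteq> UNIV \<times> (insert None (Some ` cells n m)) \<times> (insert None (Some ` cells n m))
      \<times> (insert None (Some ` {1..m}))"
  proof
    fix s :: sym assume "s \<in> {s. valid_sym n m s}"
    then show "s \<in> UNIV \<times> (insert None (Some ` cells n m)) \<times> (insert None (Some ` cells n m))
      \<times> (insert None (Some ` {1..m}))"
      by (cases "lpoint s"; cases "rpoint s"; cases "bpoint s"; cases s)
        (auto simp: valid_sym_def lpoint_def rpoint_def bpoint_def)
  qed
  then show ?thesis by (rule finite_subset) (auto simp: cells_def)
qed

lemma finite_cells: "finite (cells n m)"
  by (simp add: cells_def)

lemma finite_inputs: "finite (inputs n m)"
  by (rule finite_subset[OF _ finite_set_of_finite_funs[OF finite_cells[of n m] finite_valid_sym[of n m], of triv]])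
     (auto simp: inputs_def valid_input_def)

abbreviation column :: "nat \<Rightarrow> nat \<Rightarrow> cell set" where
  "column n j \<equiv> {1..n} \<times> {j}"

definition good_leaf :: "nat \<Rightarrow> (cell \<Rightarrow> sym) \<Rightarrow> cell \<Rightarrow> nat \<Rightarrow> nat \<Rightarrow> bool" where
  "good_leaf m x a j b \<longleftrightarrow> (\<exists>l. follow x a (tree_path m j) = Some l \<and>
               snd l = j \<and> \<not> sval (x l) \<and> bpoint (x l) = Some b)"

lemma follow_in_cells:
  assumes "valid_input n m x" "a \<in> cells n m" "follow x a ds = Some l"
  shows "l \<in> cells n m"
  using assms(2,3)
proof (induction ds arbitrary: a)
  case (Cons d ds)
  then have "valid_sym n m (x a)" using assms(1) by (auto simp: valid_input_def)
  then show ?case using Cons by (auto simp: valid_sym_def split: option.splits if_splits)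
qed simp

lemma f_nm_certificate:
  assumes "f_nm n m x"
  obtains b a where "b \<in> {1..m}" "all_ones_col n x b" "a \<in> column n b" "x a \<noteq> triv"
    "\<And>c. c \<in> column n b \<Longrightarrow> x c \<noteq> triv \<Longrightarrow> c = a"
    "\<And>j. j \<in> {1..m} - {b} \<Longrightarrow> good_leaf m x a j b"
proof -
  from assms obtain b where b: "b \<in> {1..m}" "all_ones_col n x b" unfolding f_nm_def by blast
  have "\<forall>b. b \<in> {1..m} \<and> all_ones_col n x b \<longrightarrow>
     (\<exists>!a. a \<in> column n b \<and> x a \<noteq> triv) \<and>
     (\<forall>a. a \<in> column n b \<and> x a \<noteq> triv \<longrightarrow> (\<forall>j\<in>{1..m} - {b}. good_leaf m x a j b))"
    using assms unfolding f_nm_def good_leaf_def by (rule conjunct2)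
  from mp[OF spec[OF this, of b] conjI[OF b]]
  have *: "\<exists>!a. a \<in> column n b \<and> x a \<noteq> triv"
    "\<forall>a. a \<in> column n b \<and> x a \<noteq> triv \<longrightarrow> (\<forall>j\<in>{1..m} - {b}. good_leaf m x a j b)"
    by (rule conjunct1, rule conjunct2)
  from *(1) obtain a where a: "a \<in> column n b" "x a \<noteq> triv" "\<And>c. c \<in> column n b \<Longrightarrow> x c \<noteq> triv \<Longrightarrow> c = a"
    by blast
  show ?thesis using that[OF b a] *(2) a(1,2) by blast
qed

text \<open>Uniqueness of the marked column comes from the leaves: the leaf reached in any other
  column is a cell of the grid with value 0, so that column is not all ones.\<close>

lemma f_nmI:
  assumes "valid_input n m x" "b \<in> {1..m}" "all_ones_col n x b" "a \<in> column n b" "x a \<noteq> triv"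
    and "\<And>c. c \<in> column n b \<Longrightarrow> x c \<noteq> triv \<Longrightarrow> c = a"
    and "\<And>j. j \<in> {1..m} - {b} \<Longrightarrow> good_leaf m x a j b"
  shows "f_nm n m x"
proof -
  have uniq: "b' = b" if b': "b' \<in> {1..m}" "all_ones_col n x b'" for b'
  proof (rule ccontr)
    assume "b' \<noteq> b"
    then obtain l where l: "follow x a (tree_path m b') = Some l" "snd l = b'" "\<not> sval (x l)"
      using assms(7)[of b'] b' by (auto simp: good_leaf_def)
    have "a \<in> cells n m" using assms(2,4) by (auto simp: cells_def)
    then have "l \<in> cells n m" using follow_in_cells[OF assms(1) _ l(1)] by simp
    then show False using b'(2) l by (cases l) (auto simp: cells_def all_ones_col_def)
  qed
  have ex: "\<exists>!b. b \<in> {1..m} \<and> all_ones_col n x b" using assms(2,3) uniq by blast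
  have "\<exists>!a. a \<in> column n b \<and> x a \<noteq> triv" using assms(4-6) by blast
  moreover have "\<forall>a. a \<in> column n b \<and> x a \<noteq> triv \<longrightarrow> (\<forall>j\<in>{1..m} - {b}. good_leaf m x a j b)"
    using assms(6,7) by blast
  ultimately have "\<forall>b'. b' \<in> {1..m} \<and> all_ones_col n x b' \<longrightarrow>
     (\<exists>!a. a \<in> column n b' \<and> x a \<noteq> triv) \<and>
     (\<forall>a. a \<in> column n b' \<and> x a \<noteq> triv \<longrightarrow> (\<forall>j\<in>{1..m} - {b'}. good_leaf m x a j b'))"
    using uniq by metis
  with ex show ?thesis unfolding f_nm_def good_leaf_def by (rule conjI)
qed

fun trace :: "(cell \<Rightarrow> sym) \<Rightarrow> cell \<Rightarrow> bool list \<Rightarrow> sym list" where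
  "trace x a [] = [x a]"
| "trace x a (d # ds) = x a #
     (case (if d then rpoint (x a) else lpoint (x a)) of None \<Rightarrow> [] | Some a' \<Rightarrow> trace x a' ds)"

lemma trace_eq_follow:
  assumes "trace x a ds = trace y a ds"
  shows "follow x a ds = follow y a ds \<and> (\<forall>l. follow x a ds = Some l \<longrightarrow> x l = y l)"
  using assms by (induction ds arbitrary: a) (auto split: option.splits if_splits)

lemma trace_eq_good_leaf:
  assumes "trace x a (tree_path m j) = trace y a (tree_path m j)"
  shows "good_leaf m x a j b \<longleftrightarrow> good_leaf m y a j b"
  using trace_eq_follow[OF assms] by (auto simp: good_leaf_def)

text \<open>Cells with value 1 are given no target because the leaves of a positive input are
  zeros.\<close>

definition target :: "sym \<Rightarrow> nat option" where
  "target s = (if sval s then None else bpoint s)"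

text \<open>The added 1 keeps the weight positive on an all-ones column, which thereby becomes the
  most attractive destination.\<close>

definition wt :: "nat \<Rightarrow> nat \<Rightarrow> (cell \<Rightarrow> sym) \<Rightarrow> real" where
  "wt n b x = 1 + (\<Sum>c\<in>column n b. of_bool (\<not> sval (x c)))"

definition rate :: "nat \<Rightarrow> sym \<Rightarrow> (cell \<Rightarrow> sym) \<Rightarrow> real" where
  "rate n s x = (case target s of None \<Rightarrow> 0 | Some b \<Rightarrow> 1 / wt n b x)"

text \<open>Normalisation of the walk in column \<open>j\<close>; the leading 1 is the weight of
  stopping.\<close>

definition total_rate :: "nat \<Rightarrow> nat \<Rightarrow> (cell \<Rightarrow> sym) \<Rightarrow> real" where
  "total_rate n j x = 1 + (\<Sum>c\<in>column n j. rate n (x c) x)"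

lemma wt_ge_1: "wt n b x \<ge> 1"
  by (simp add: wt_def sum_nonneg)

lemma wt_le: "wt n b x \<le> 1 + real n"
  using sum_of_bool_le_card[of "\<lambda>c. \<not> sval (x c)" "column n b"] by (simp add: wt_def)

lemma rate_bounds: "0 \<le> rate n s x" "rate n s x \<le> 1"
  using wt_ge_1 order.trans[OF zero_le_one wt_ge_1] by (auto simp: rate_def divide_le_eq_1 split: option.split)

lemma total_rate_ge_1: "total_rate n j x \<ge> 1"
  by (simp add: total_rate_def sum_nonneg rate_bounds)

lemma total_rate_le: "total_rate n j x \<le> 1 + real n"
  using sum_mono[of "column n j" "\<lambda>c. rate n (x c) x" "\<lambda>_. 1"] rate_bounds by (simp add: total_rate_def)

locale grid =
  fixes n m :: nat and depth :: real
  assumes n: "n \<ge> 1" and m: "m \<ge> 1"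
    and depth: "\<And>j. real (length (tree_path m j)) + 1 \<le> depth"
begin

abbreviation "pos \<equiv> {x \<in> inputs n m. f_nm n m x}"
abbreviation "neg \<equiv> {x \<in> inputs n m. \<not> f_nm n m x}"

sublocale adversary "cells n m" pos neg
  by unfold_locales (use finite_cells finite_inputs in auto)

lemma depth_ge_1: "depth \<ge> 1"
  using depth[of 0] by linarith

lemma column_subset: "b \<in> {1..m} \<Longrightarrow> column n b \<subseteq> cells n m"
  by (auto simp: cells_def)

lemma valid_symD:
  assumes "c \<in> cells n m" "s \<in> (\<lambda>x. x c) ` (pos \<union> neg)"
  shows "valid_sym n m s"
  using assms by (auto simp: inputs_def valid_input_def)

text \<open>Query the first cell; if the symbols agree, both inputs continue at the same cell, and
  \<open>adm_cond\<close> applies the induction hypothesis at no extra factor. The additional 1 in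
  the cost is the reading of the last cell.\<close>

lemma adm_trace:
  assumes "a \<in> cells n m"
  shows "adm (\<lambda>x y. of_bool (trace x a ds \<noteq> trace y a ds)) (\<lambda>_. real (length ds) + 1) (\<lambda>_. real (length ds) + 1)"
  using assms
proof (induction ds arbitrary: a)
  case Nil
  then show ?case by (intro adm_mono[OF adm_query[of a]]) auto
next
  case (Cons d ds)
  define p where "p s = (if d then rpoint s else lpoint s)" for s :: sym
  define K where "K s x y = (case p s of None \<Rightarrow> 0 :: real | Some a' \<Rightarrow> of_bool (trace x a' ds \<noteq> trace y a' ds))" for s x y
  have "adm (K s) (\<lambda>_. real (length ds) + 1) (\<lambda>_. real (length ds) + 1)" if "s \<in> (\<lambda>x. x a) ` (pos \<union> neg)" for s
  proof (cases "p s")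
    case None
    then show ?thesis by (intro adm_mono[OF adm_zero]) (auto simp: K_def)
  next
    case (Some a')
    then have "a' \<in> cells n m" using valid_symD[OF Cons.prems that] by (cases d) (simp_all add: p_def valid_sym_def)
    from Cons.IH[OF this] show ?thesis by (rule adm_mono) (auto simp: K_def Some)
  qed
  from adm_add[OF adm_query[OF Cons.prems] adm_cond[OF this]]
  show ?case by (rule adm_mono) (auto simp: K_def p_def split: option.splits)
qed

text \<open>The choice ranges over columns with a full certificate, so that \<open>special\<close>
  can be chosen afterwards. Only the values at positive inputs matter.\<close>

definition marked :: "(cell \<Rightarrow> sym) \<Rightarrow> nat" where
  "marked x = (SOME b. \<exists>a. b \<in> {1..m} \<and> all_ones_col n x b \<and> a \<in> column n b \<and> x a \<noteq> triv \<and>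
     (\<forall>c\<in>column n b. x c \<noteq> triv \<longrightarrow> c = a) \<and> (\<forall>j\<in>{1..m} - {b}. good_leaf m x a j b))"

definition special :: "(cell \<Rightarrow> sym) \<Rightarrow> cell" where
  "special x = (SOME a. a \<in> column n (marked x) \<and> x a \<noteq> triv \<and>
     (\<forall>c\<in>column n (marked x). x c \<noteq> triv \<longrightarrow> c = a) \<and> (\<forall>j\<in>{1..m} - {marked x}. good_leaf m x a j (marked x)))"

lemma marked_special:
  assumes "x \<in> pos"
  shows "marked x \<in> {1..m}" "all_ones_col n x (marked x)" "special x \<in> column n (marked x)" "x (special x) \<noteq> triv"
    "\<And>c. c \<in> column n (marked x) \<Longrightarrow> x c \<noteq> triv \<Longrightarrow> c = special x"
    "\<And>j. j \<in> {1..m} - {marked x} \<Longrightarrow> good_leaf m x (special x) j (marked x)"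
proof -
  from assms have "f_nm n m x" by simp
  then obtain b a where "b \<in> {1..m}" "all_ones_col n x b" "a \<in> column n b" "x a \<noteq> triv"
    "\<And>c. c \<in> column n b \<Longrightarrow> x c \<noteq> triv \<Longrightarrow> c = a"
    "\<And>j. j \<in> {1..m} - {b} \<Longrightarrow> good_leaf m x a j b" by (rule f_nm_certificate) blast
  then have "\<exists>b a. b \<in> {1..m} \<and> all_ones_col n x b \<and> a \<in> column n b \<and> x a \<noteq> triv \<and>
     (\<forall>c\<in>column n b. x c \<noteq> triv \<longrightarrow> c = a) \<and> (\<forall>j\<in>{1..m} - {b}. good_leaf m x a j b)" by blast
  from someI_ex[OF this] have *: "\<exists>a. marked x \<in> {1..m} \<and> all_ones_col n x (marked x) \<and> a \<in> column n (marked x) \<and> x a \<noteq> triv \<and>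
     (\<forall>c\<in>column n (marked x). x c \<noteq> triv \<longrightarrow> c = a) \<and> (\<forall>j\<in>{1..m} - {marked x}. good_leaf m x a j (marked x))"
    unfolding marked_def by blast
  then show "marked x \<in> {1..m}" "all_ones_col n x (marked x)" by auto
  from * have "\<exists>a. a \<in> column n (marked x) \<and> x a \<noteq> triv \<and>
     (\<forall>c\<in>column n (marked x). x c \<noteq> triv \<longrightarrow> c = a) \<and> (\<forall>j\<in>{1..m} - {marked x}. good_leaf m x a j (marked x))"
    by auto
  from someI_ex[OF this, folded special_def]
  show "special x \<in> column n (marked x)" "x (special x) \<noteq> triv"
    "\<And>c. c \<in> column n (marked x) \<Longrightarrow> x c \<noteq> triv \<Longrightarrow> c = special x"
    "\<And>j. j \<in> {1..m} - {marked x} \<Longrightarrow> good_leaf m x (special x) j (marked x)" by blast+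
qed

end

section \<open>Verification of a column\<close>

lemma sum_of_bool_pair_le:
  assumes "finite A" "finite B" "\<And>e. e \<in> A \<times> B \<Longrightarrow> P e \<Longrightarrow> fst e = s"
  shows "(\<Sum>e\<in>A \<times> B. of_bool (P e)) \<le> real (card B)"
proof -
  have "(\<Sum>e\<in>A \<times> B. of_bool (P e)) = real (card (A \<times> B \<inter> {e. P e}))"
    using assms(1,2) by simp
  also have "card (A \<times> B \<inter> {e. P e}) \<le> card ({s} \<times> B)"
    using assms by (intro card_mono) auto
  finally show ?thesis by (simp add: card_cartesian_product)
qed

context grid
begin

definition verify_cost :: real where
  "verify_cost = 5 * sqrt n + sqrt m * depth"

lemma verify_cost_nonneg: "verify_cost \<ge> 0"
  using depth_ge_1 by (simp add: verify_cost_def)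

lemma div_sqrt: "real n / sqrt n = sqrt n" "1 / sqrt n * real n = sqrt n"
   "1 / sqrt m * (real m * d) = sqrt m * d"
proof -
  show "real n / sqrt n = sqrt n" by (simp add: real_div_sqrt)
  then show "1 / sqrt n * real n = sqrt n" by simp
  have "real m / sqrt m = sqrt m" by (simp add: real_div_sqrt)
  then show "1 / sqrt m * (real m * d) = sqrt m * d"
    by (metis mult.assoc mult_1 times_divide_eq_left)
qed

text \<open>For negative \<open>y\<close> with \<open>z y\<close> zeros in column \<open>b\<close>, verification is cheaper by the factor \<open>1 / z y\<close>. If \<open>z y = 0\<close>, the four
  kernels \<open>ka\<close>-\<open>kd\<close> cover the ways in which the special elements of \<open>x\<close> and \<open>y\<close> can be related.\<close>

lemma adm_verify:
  assumes b: "b \<in> {1..m}"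
  shows "adm (\<lambda>x y. of_bool (marked x = b)) (\<lambda>_. verify_cost) (\<lambda>y. verify_cost / wt n b y)"
proof -
  define col where "col = column n b"
  define z where "z y = (\<Sum>c\<in>col. of_bool (\<not> sval (y c)) :: real)" for y :: "cell \<Rightarrow> sym"
  have fin: "finite col" and card: "card col = n" by (simp_all add: col_def)
  have sub: "c \<in> cells n m" if "c \<in> col" for c using that column_subset[OF b] by (auto simp: col_def)
  have wz: "wt n b y = 1 + z y" for y by (simp add: wt_def z_def col_def)
  have z0: "z y \<ge> 0" for y by (simp add: z_def sum_nonneg)
  have z_eq0: "z y = 0 \<longleftrightarrow> (\<forall>c\<in>col. sval (y c))" for y
    unfolding z_def by (subst sum_nonneg_eq_0_iff) (use fin in auto)
  have z_ge1: "z y \<ge> 1" if "z y > 0" for y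
  proof -
    have "z y = real (card (col \<inter> {c. \<not> sval (y c)}))" unfolding z_def using fin by simp
    then show ?thesis using that by auto
  qed
  have sn: "sqrt n \<ge> 1" "sqrt n > 0" "sqrt m > 0" using n m by auto
  note ms = marked_special
  have mt: "x c = triv" if "x \<in> pos" "marked x = b" "c \<in> col" "c \<noteq> special x" for x c
    using ms(5)[OF that(1), of c] that by (auto simp: col_def)
  have mspec: "special x \<in> col" "x (special x) \<noteq> triv" if "x \<in> pos" "marked x = b" for x
    using ms(3,4)[OF that(1)] that(2) by (auto simp: col_def)
  have query: "adm (\<lambda>x y. if x c = y c then 0 else 1) (\<lambda>_. 1) (\<lambda>_. 1)" if "c \<in> col" for c
    by (rule adm_query) (rule sub[OF that])

  \<comment> \<open>Selectors may look at one input only. For negative \<open>y\<close> without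
    zeros in the column, \<open>p1\<close>, \<open>p2\<close> and \<open>bad\<close> fix a witness
    against \<open>b\<close>: two nontrivial cells, or a leaf that fails from the only one.\<close>
  define S where "S y = {c \<in> col. y c \<noteq> triv}" for y :: "cell \<Rightarrow> sym"
  define p1 where "p1 y = (SOME c. c \<in> S y)" for y
  define two where "two y \<longleftrightarrow> (\<exists>c\<in>S y. c \<noteq> p1 y)" for y
  define p2 where "p2 y = (SOME c. c \<in> S y \<and> c \<noteq> p1 y)" for y
  define bad where "bad y = (SOME j. j \<in> {1..m} - {b} \<and> \<not> good_leaf m y (p1 y) j b)" for y
  have p1: "p1 y \<in> S y" if "S y \<noteq> {}" for y
    unfolding p1_def by (rule someI_ex) (use that in auto)
  have p2: "p2 y \<in> S y \<and> p2 y \<noteq> p1 y" if "two y" for y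
    unfolding p2_def by (rule someI_ex) (use that two_def in auto)
  have bad: "bad y \<in> {1..m} - {b} \<and> \<not> good_leaf m y (p1 y) (bad y) b"
    if y: "y \<in> neg" and "z y = 0" and "S y \<noteq> {}" and "\<not> two y" for y
  proof -
    have "\<exists>j. j \<in> {1..m} - {b} \<and> \<not> good_leaf m y (p1 y) j b"
    proof (rule ccontr)
      assume *: "\<not> ?thesis"
      have "f_nm n m y"
      proof (rule f_nmI[of n m y b "p1 y"])
        show "valid_input n m y" using y by (auto simp: inputs_def)
        show "all_ones_col n y b" using \<open>z y = 0\<close> by (auto simp: z_eq0 all_ones_col_def col_def)
        show "p1 y \<in> column n b" "y (p1 y) \<noteq> triv" using p1[OF that(3)] by (auto simp: S_def col_def)
        show "c = p1 y" if "c \<in> column n b" "y c \<noteq> triv" for c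
          using \<open>\<not> two y\<close> that by (auto simp: two_def S_def col_def)
      qed (use b * in auto)
      then show False using y by simp
    qed
    from someI_ex[OF this] show ?thesis by (simp add: bad_def)
  qed

  \<comment> \<open>Since \<open>x\<close> has only ones in its marked column, every zero of
    \<open>y\<close> is a difference. Spreading weight \<open>1 / z y\<close> over all of them costs
    \<open>y\<close> only \<open>1 / z y\<close>, which is at most \<open>2 / wt n b y\<close>
    because \<open>z y\<close> is a positive integer.\<close>
  have k0: "adm (\<lambda>x y. of_bool (marked x = b \<and> z y > 0)) (\<lambda>_. sqrt n) (\<lambda>y. of_bool (z y > 0) * (2 * sqrt n / wt n b y))"
  proof (rule adm_mono[OF adm_rescale[OF adm_sum[where \<alpha> = "\<lambda>c x. of_bool (marked x = b)"
          and \<beta> = "\<lambda>c y. of_bool (\<not> sval (y c)) / z y", OF fin query], where s = "1 / sqrt n"]])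
    fix x y assume xy: "x \<in> pos" "y \<in> neg"
    show "of_bool (marked x = b \<and> z y > 0) = (\<Sum>c\<in>col. of_bool (marked x = b) *
        (of_bool (\<not> sval (y c)) / z y) * (if x c = y c then 0 else 1))"
    proof (cases "marked x = b")
      case True
      have "(\<Sum>c\<in>col. of_bool (marked x = b) * (of_bool (\<not> sval (y c)) / z y) * (if x c = y c then 0 else 1))
         = (\<Sum>c\<in>col. of_bool (\<not> sval (y c)) / z y)"
      proof (rule sum.cong[OF refl])
        fix c assume "c \<in> col"
        then have "sval (x c)" using ms(2)[OF xy(1)] True by (auto simp: col_def all_ones_col_def)
        then show "of_bool (marked x = b) * (of_bool (\<not> sval (y c)) / z y) * (if x c = y c then 0 else 1)
          = of_bool (\<not> sval (y c)) / z y" using True by auto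
      qed
      also have "\<dots> = z y / z y" by (simp only: sum_divide_distrib[symmetric] z_def[symmetric])
      finally show ?thesis using True z0[of y] by auto
    qed simp
  next
    fix x
    have "(\<Sum>c\<in>col. (of_bool (marked x = b))\<^sup>2 * 1) \<le> (\<Sum>c\<in>col. 1 :: real)" by (rule sum_mono) auto
    then have "1 / sqrt n * (\<Sum>c\<in>col. (of_bool (marked x = b))\<^sup>2 * 1) \<le> 1 / sqrt n * real n"
      using card by (intro mult_left_mono) auto
    then show "1 / sqrt n * (\<Sum>c\<in>col. (of_bool (marked x = b))\<^sup>2 * 1) \<le> sqrt n"
      using div_sqrt by simp
  next
    fix y
    have "(\<Sum>c\<in>col. (of_bool (\<not> sval (y c)) / z y)\<^sup>2 * 1) = (\<Sum>c\<in>col. of_bool (\<not> sval (y c))) / (z y)\<^sup>2"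
      unfolding sum_divide_distrib by (intro sum.cong) (auto simp: power_divide)
    also have "\<dots> = z y / (z y)\<^sup>2" by (simp add: z_def)
    also have "\<dots> \<le> of_bool (z y > 0) * (2 / wt n b y)"
    proof (cases "z y > 0")
      case True
      then have "z y / (z y)\<^sup>2 = 1 / z y" by (simp add: power2_eq_square)
      also have "\<dots> \<le> 2 / wt n b y" using z_ge1[OF True] by (simp add: wz field_simps)
      finally show ?thesis using True by simp
    qed (use z0[of y] in auto)
    finally have "(\<Sum>c\<in>col. (of_bool (\<not> sval (y c)) / z y)\<^sup>2 * 1) * sqrt n
        \<le> of_bool (z y > 0) * (2 / wt n b y) * sqrt n" by (rule mult_right_mono) simp
    then show "(\<Sum>c\<in>col. (of_bool (\<not> sval (y c)) / z y)\<^sup>2 * 1) / (1 / sqrt n)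
        \<le> of_bool (z y > 0) * (2 * sqrt n / wt n b y)" by simp
  qed (use sn in auto)

  have ka: "adm (\<lambda>x y. of_bool (marked x = b \<and> z y = 0 \<and> S y = {})) (\<lambda>_. 1 * 1) (\<lambda>y. (of_bool (z y = 0) * real n) * 1)"
  proof (rule adm_sum_bool[where E = col and \<alpha> = "\<lambda>c x. marked x = b \<and> special x = c"
        and \<beta> = "\<lambda>c y. z y = 0 \<and> S y = {}" and K = "\<lambda>c x y. if x c = y c then 0 else 1"])
    fix x assume "x \<in> pos"
    show "(\<Sum>c\<in>col. of_bool (marked x = b \<and> special x = c)) \<le> (1 :: real)"
      by (rule sum_of_bool_le_1[OF fin]) auto
  next
    fix y
    show "(\<Sum>c\<in>col. of_bool (z y = 0 \<and> S y = {})) \<le> of_bool (z y = 0) * real n"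
      using card by simp
  next
    fix x y assume xy: "x \<in> pos" "y \<in> neg"
    show "of_bool (marked x = b \<and> z y = 0 \<and> S y = {}) = (\<Sum>c\<in>col. of_bool (marked x = b \<and> special x = c) *
        of_bool (z y = 0 \<and> S y = {}) * (if x c = y c then 0 else 1 :: real))"
    proof (cases "marked x = b \<and> z y = 0 \<and> S y = {}")
      case True
      then have "special x \<notin> S y" by simp
      then have "y (special x) = triv" using mspec(1)[OF xy(1)] True unfolding S_def by blast
      then show ?thesis using True mspec[OF xy(1)] by (subst sum_single[OF fin mspec(1)[OF xy(1)]]) auto
    qed (auto intro!: sum.neutral)
  qed (use fin query in auto)

  have kb: "adm (\<lambda>x y. of_bool (marked x = b \<and> z y = 0 \<and> S y \<noteq> {} \<and> special x \<noteq> p1 y)) (\<lambda>_. real n * 1) (\<lambda>y. (of_bool (z y = 0)) * 1)"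
  proof (rule adm_sum_bool[where E = col and \<alpha> = "\<lambda>c x. marked x = b \<and> special x \<noteq> c"
        and \<beta> = "\<lambda>c y. z y = 0 \<and> S y \<noteq> {} \<and> p1 y = c" and K = "\<lambda>c x y. if x c = y c then 0 else 1"])
    fix x
    show "(\<Sum>c\<in>col. of_bool (marked x = b \<and> special x \<noteq> c)) \<le> real n"
      using sum_of_bool_le_card[of _ col] card by simp
  next
    fix y
    show "(\<Sum>c\<in>col. of_bool (z y = 0 \<and> S y \<noteq> {} \<and> p1 y = c)) \<le> (of_bool (z y = 0) :: real)"
    proof (cases "z y = 0")
      case True
      then show ?thesis using sum_of_bool_le_1[OF fin, of "\<lambda>c. z y = 0 \<and> S y \<noteq> {} \<and> p1 y = c"] by simp
    qed simp
  next
    fix x y assume xy: "x \<in> pos" "y \<in> neg"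
    show "of_bool (marked x = b \<and> z y = 0 \<and> S y \<noteq> {} \<and> special x \<noteq> p1 y) =
      (\<Sum>c\<in>col. of_bool (marked x = b \<and> special x \<noteq> c) *
        of_bool (z y = 0 \<and> S y \<noteq> {} \<and> p1 y = c) * (if x c = y c then 0 else 1 :: real))"
    proof (cases "marked x = b \<and> z y = 0 \<and> S y \<noteq> {} \<and> special x \<noteq> p1 y")
      case True
      then have "p1 y \<in> col" "y (p1 y) \<noteq> triv" using p1[of y] by (auto simp: S_def)
      moreover have "x (p1 y) = triv" using mt[OF xy(1) _ calculation(1)] True by metis
      ultimately show ?thesis using True by (subst sum_single[OF fin, of "p1 y"]) auto
    qed (auto intro!: sum.neutral)
  qed (use fin query in auto)

  \<comment> \<open>Indexing by pairs lets the first component test \<open>special x = p1 y\<close>,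
    while the query is made at the second, \<open>p2 y\<close>, where \<open>x\<close> is
    trivial.\<close>
  have kc: "adm (\<lambda>x y. of_bool (marked x = b \<and> z y = 0 \<and> two y \<and> special x = p1 y)) (\<lambda>_. real n * 1) (\<lambda>y. (of_bool (z y = 0)) * 1)"
  proof (rule adm_sum_bool[where E = "col \<times> col" and \<alpha> = "\<lambda>e x. marked x = b \<and> special x = fst e \<and> snd e \<noteq> fst e"
        and \<beta> = "\<lambda>e y. z y = 0 \<and> two y \<and> p1 y = fst e \<and> p2 y = snd e" and K = "\<lambda>e x y. if x (snd e) = y (snd e) then 0 else 1"])
    fix x
    show "(\<Sum>e\<in>col \<times> col. of_bool (marked x = b \<and> special x = fst e \<and> snd e \<noteq> fst e)) \<le> real n"
      by (rule order.trans[OF sum_of_bool_pair_le[OF fin fin, of _ "special x"]]) (use card in auto)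
  next
    fix y
    show "(\<Sum>e\<in>col \<times> col. of_bool (z y = 0 \<and> two y \<and> p1 y = fst e \<and> p2 y = snd e)) \<le> (of_bool (z y = 0) :: real)"
    proof (cases "z y = 0")
      case True
      have "(\<Sum>e\<in>col \<times> col. of_bool (z y = 0 \<and> two y \<and> p1 y = fst e \<and> p2 y = snd e)) \<le> (1 :: real)"
        by (rule sum_of_bool_le_1) (use fin in auto)
      then show ?thesis using True by simp
    qed simp
  next
    fix x y assume xy: "x \<in> pos" "y \<in> neg"
    show "of_bool (marked x = b \<and> z y = 0 \<and> two y \<and> special x = p1 y) =
      (\<Sum>e\<in>col \<times> col. of_bool (marked x = b \<and> special x = fst e \<and> snd e \<noteq> fst e) *
        of_bool (z y = 0 \<and> two y \<and> p1 y = fst e \<and> p2 y = snd e) * (if x (snd e) = y (snd e) then 0 else 1 :: real))"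
    proof (cases "marked x = b \<and> z y = 0 \<and> two y \<and> special x = p1 y")
      case True
      then have "p1 y \<in> col" using mspec[OF xy(1)] by auto
      moreover have p: "p2 y \<in> col" "y (p2 y) \<noteq> triv" "p2 y \<noteq> p1 y" using p2[of y] True by (auto simp: S_def)
      moreover have "x (p2 y) = triv" using mt[OF xy(1) _ p(1)] p(3) True by metis
      ultimately show ?thesis using True fin by (subst sum_single[of _ "(p1 y, p2 y)"]) auto
    qed (auto intro!: sum.neutral)
  qed (use fin query in auto)

  define J where "J = {1..m} - {b}"
  have finJ: "finite J" and cardJ: "card J \<le> m" using b by (auto simp: J_def)
  \<comment> \<open>Here the witness is a path: it leads to a good leaf in \<open>x\<close> but not
    in \<open>y\<close>, so the traces differ. There are at most \<open>m\<close> candidates on the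
    side of \<open>x\<close> and one on the side of \<open>y\<close>.\<close>
  have kd: "adm (\<lambda>x y. of_bool (marked x = b \<and> z y = 0 \<and> S y \<noteq> {} \<and> \<not> two y \<and> special x = p1 y))
      (\<lambda>_. real m * depth) (\<lambda>y. (of_bool (z y = 0)) * depth)"
  proof (rule adm_sum_bool[where E = "col \<times> J" and \<alpha> = "\<lambda>e x. marked x = b \<and> special x = fst e"
        and \<beta> = "\<lambda>e y. z y = 0 \<and> S y \<noteq> {} \<and> \<not> two y \<and> p1 y = fst e \<and> bad y = snd e"
        and K = "\<lambda>e x y. of_bool (trace x (fst e) (tree_path m (snd e)) \<noteq> trace y (fst e) (tree_path m (snd e)))"])
    fix e assume "e \<in> col \<times> J"
    then have "fst e \<in> cells n m" using sub by auto
    from adm_trace[OF this, of "tree_path m (snd e)"]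
    show "adm (\<lambda>x y. of_bool (trace x (fst e) (tree_path m (snd e)) \<noteq> trace y (fst e) (tree_path m (snd e))))
       (\<lambda>_. depth) (\<lambda>_. depth)"
      by (rule adm_mono) (use depth in auto)
  next
    fix x
    show "(\<Sum>e\<in>col \<times> J. of_bool (marked x = b \<and> special x = fst e)) \<le> real m"
      by (rule order.trans[OF sum_of_bool_pair_le[OF fin finJ, of _ "special x"]]) (use cardJ in auto)
  next
    fix y
    show "(\<Sum>e\<in>col \<times> J. of_bool (z y = 0 \<and> S y \<noteq> {} \<and> \<not> two y \<and> p1 y = fst e \<and> bad y = snd e)) \<le> (of_bool (z y = 0) :: real)"
    proof (cases "z y = 0")
      case True
      have "(\<Sum>e\<in>col \<times> J. of_bool (z y = 0 \<and> S y \<noteq> {} \<and> \<not> two y \<and> p1 y = fst e \<and> bad y = snd e)) \<le> (1 :: real)"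
        by (rule sum_of_bool_le_1) (use fin finJ in auto)
      then show ?thesis using True by simp
    qed simp
  next
    fix x y assume xy: "x \<in> pos" "y \<in> neg"
    show "of_bool (marked x = b \<and> z y = 0 \<and> S y \<noteq> {} \<and> \<not> two y \<and> special x = p1 y) =
      (\<Sum>e\<in>col \<times> J. of_bool (marked x = b \<and> special x = fst e) *
        of_bool (z y = 0 \<and> S y \<noteq> {} \<and> \<not> two y \<and> p1 y = fst e \<and> bad y = snd e) *
        of_bool (trace x (fst e) (tree_path m (snd e)) \<noteq> trace y (fst e) (tree_path m (snd e))) :: real)"
    proof (cases "marked x = b \<and> z y = 0 \<and> S y \<noteq> {} \<and> \<not> two y \<and> special x = p1 y")
      case True
      then have "p1 y \<in> col" using mspec[OF xy(1)] by auto
      moreover have bd: "bad y \<in> J" "\<not> good_leaf m y (p1 y) (bad y) b" using bad[OF xy(2)] True by (auto simp: J_def)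
      moreover have "good_leaf m x (p1 y) (bad y) b" using ms(6)[OF xy(1)] True bd by (auto simp: J_def)
      then have "trace x (p1 y) (tree_path m (bad y)) \<noteq> trace y (p1 y) (tree_path m (bad y))"
        using trace_eq_good_leaf bd(2) by blast
      ultimately show ?thesis using True fin finJ by (subst sum_single[of _ "(p1 y, bad y)"]) auto
    next
      case False
      then show ?thesis by (subst sum.neutral) auto
    qed
  qed (use fin finJ depth_ge_1 in auto)

  show ?thesis
  proof (rule adm_mono[OF adm_add[OF k0 adm_add[OF adm_rescale[OF ka sn(2)] adm_add[OF adm_rescale[OF kb, where s = "1 / sqrt n"]
            adm_add[OF adm_rescale[OF kc, where s = "1 / sqrt n"] adm_rescale[OF kd, where s = "1 / sqrt m"]]]]]])
    fix x y assume "x \<in> pos" "y \<in> neg"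
    show "of_bool (marked x = b) = of_bool (marked x = b \<and> z y > 0) + (of_bool (marked x = b \<and> z y = 0 \<and> S y = {}) +
      (of_bool (marked x = b \<and> z y = 0 \<and> S y \<noteq> {} \<and> special x \<noteq> p1 y) +
      (of_bool (marked x = b \<and> z y = 0 \<and> two y \<and> special x = p1 y) +
       of_bool (marked x = b \<and> z y = 0 \<and> S y \<noteq> {} \<and> \<not> two y \<and> special x = p1 y) :: real)))"
      using z0[of y] by (cases "z y = 0"; cases "S y = {}") (auto simp: two_def)
  next
    fix x
    have "sqrt n + (sqrt n * (1 * 1) + (1 / sqrt n * (real n * 1) + (1 / sqrt n * (real n * 1) +
       1 / sqrt m * (real m * depth)))) = 4 * sqrt n + sqrt m * depth"
      by (simp only: mult_1_right div_sqrt)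
    also have "\<dots> \<le> verify_cost" using sn by (simp add: verify_cost_def)
    finally show "sqrt n + (sqrt n * (1 * 1) + (1 / sqrt n * (real n * 1) + (1 / sqrt n * (real n * 1) +
       1 / sqrt m * (real m * depth)))) \<le> verify_cost" .
  next
    fix y
    show "of_bool (z y > 0) * (2 * sqrt n / wt n b y) + (of_bool (z y = 0) * real n * 1 / sqrt n +
       (of_bool (z y = 0) * 1 / (1 / sqrt n) + (of_bool (z y = 0) * 1 / (1 / sqrt n) +
        of_bool (z y = 0) * depth / (1 / sqrt m)))) \<le> verify_cost / wt n b y"
    proof (cases "z y = 0")
      case True
      then show ?thesis using sn div_sqrt(1) by (simp add: wz verify_cost_def mult.commute)
    next
      case False
      have "2 * sqrt n \<le> verify_cost" using depth_ge_1 by (simp add: verify_cost_def)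
      then have "2 * sqrt n / wt n b y \<le> verify_cost / wt n b y"
        using wt_ge_1[of n b y] by (intro divide_right_mono) auto
      then show ?thesis using False z0[of y] by auto
    qed
  qed (use sn in auto)
qed

end

section \<open>The walk on columns\<close>

context grid
begin

text \<open>Agreement on cell \<open>c\<close> makes its target common knowledge, so the kernel for
  that target can be used.\<close>

lemma adm_jump:
  assumes c: "c \<in> cells n m" and K: "\<And>b. b \<in> {1..m} \<Longrightarrow> adm (K b) (A b) (B b)"
  shows "adm (\<lambda>x y. if x c = y c then case target (x c) of None \<Rightarrow> 0 | Some b \<Rightarrow> K b x y else 0)
    (\<lambda>x. case target (x c) of None \<Rightarrow> 0 | Some b \<Rightarrow> A b x) (\<lambda>y. case target (y c) of None \<Rightarrow> 0 | Some b \<Rightarrow> B b y)"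
proof (rule adm_cond[where g = "\<lambda>x. x c" and K = "\<lambda>s x y. case target s of None \<Rightarrow> 0 | Some b \<Rightarrow> K b x y"
      and A = "\<lambda>s x. case target s of None \<Rightarrow> 0 | Some b \<Rightarrow> A b x" and B = "\<lambda>s y. case target s of None \<Rightarrow> 0 | Some b \<Rightarrow> B b y"])
  fix s assume s: "s \<in> (\<lambda>x. x c) ` (pos \<union> neg)"
  show "adm (\<lambda>x y. case target s of None \<Rightarrow> 0 | Some b \<Rightarrow> K b x y)
     (\<lambda>x. case target s of None \<Rightarrow> 0 | Some b \<Rightarrow> A b x) (\<lambda>y. case target s of None \<Rightarrow> 0 | Some b \<Rightarrow> B b y)"
  proof (cases "target s")
    case None
    then show ?thesis using adm_zero by simp
  next
    case (Some b)
    then have "b \<in> {1..m}" using valid_symD[OF c s] by (auto simp: target_def valid_sym_def split: if_splits)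
    then show ?thesis using K Some by simp
  qed
qed

definition leaf :: "(cell \<Rightarrow> sym) \<Rightarrow> nat \<Rightarrow> cell" where
  "leaf x j = the (follow x (special x) (tree_path m j))"

lemma leaf:
  assumes x: "x \<in> pos" and j: "j \<in> {1..m}" "marked x \<noteq> j"
  shows "leaf x j \<in> column n j" "target (x (leaf x j)) = Some (marked x)"
proof -
  from marked_special(6)[OF x, of j] j obtain l where
    l: "follow x (special x) (tree_path m j) = Some l" "snd l = j" "\<not> sval (x l)" "bpoint (x l) = Some (marked x)"
    by (auto simp: good_leaf_def)
  have "special x \<in> cells n m" using marked_special(1,3)[OF x] by (auto simp: cells_def)
  then have "l \<in> cells n m" using follow_in_cells[OF _ _ l(1)] x by (auto simp: inputs_def)
  then have "l \<in> column n j" using l(2) by (cases l) (auto simp: cells_def)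
  then show "leaf x j \<in> column n j" "target (x (leaf x j)) = Some (marked x)"
    using l by (simp_all add: leaf_def target_def)
qed

definition direct_cost :: real where
  "direct_cost = 2 * verify_cost + sqrt n"

lemma direct_cost_nonneg: "direct_cost \<ge> 0"
  using verify_cost_nonneg by (simp add: direct_cost_def)

text \<open>Three cases: \<open>j\<close> is the marked column; or the leaf of \<open>x\<close> in
  column \<open>j\<close> is a difference to \<open>y\<close>; or \<open>y\<close> has the same
  symbol there and hence points to the marked column of \<open>x\<close>, which is then
  verified.\<close>

lemma adm_direct:
  assumes j: "j \<in> {1..m}"
  shows "adm (\<lambda>_ _. 1) (\<lambda>_. direct_cost) (\<lambda>y. direct_cost * total_rate n j y)"
proof -
  define col where "col = column n j"
  have fin: "finite col" and card: "card col = n" by (simp_all add: col_def)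
  have sub: "c \<in> cells n m" if "c \<in> col" for c using that column_subset[OF j] by (auto simp: col_def)
  have lf: "leaf x j \<in> col" "target (x (leaf x j)) = Some (marked x)" if "x \<in> pos" "marked x \<noteq> j" for x
    using leaf[OF that(1) j that(2)] by (auto simp: col_def)
  have sn: "sqrt n > 0" using n by simp
  have sel: "(\<Sum>c\<in>col. of_bool (marked x \<noteq> j \<and> leaf x j = c)) \<le> (1 :: real)" for x
    by (rule sum_of_bool_le_1[OF fin]) auto
  have e2: "adm (\<lambda>x y. of_bool (marked x \<noteq> j \<and> x (leaf x j) \<noteq> y (leaf x j))) (\<lambda>_. 1 * 1) (\<lambda>_. real n * 1)"
  proof (rule adm_sum_bool[where E = col and \<alpha> = "\<lambda>c x. marked x \<noteq> j \<and> leaf x j = c"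
        and \<beta> = "\<lambda>_ _. True" and K = "\<lambda>c x y. if x c = y c then 0 else 1"])
    fix c assume "c \<in> col"
    then show "adm (\<lambda>x y. if x c = y c then 0 else 1) (\<lambda>_. 1) (\<lambda>_. 1)" by (intro adm_query sub)
  next
    fix x y assume xy: "x \<in> pos" "y \<in> neg"
    show "of_bool (marked x \<noteq> j \<and> x (leaf x j) \<noteq> y (leaf x j)) = (\<Sum>c\<in>col.
       of_bool (marked x \<noteq> j \<and> leaf x j = c) * of_bool True * (if x c = y c then 0 else 1 :: real))"
    proof (cases "marked x \<noteq> j")
      case True
      then show ?thesis by (subst sum_single[OF fin lf(1)[OF xy(1) True]]) auto
    qed simp
  qed (use fin sel card in auto)
  \<comment> \<open>The side of \<open>y\<close> does not know which cell is the leaf and pays for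
    all its pointers. The factor \<open>1 / wt\<close> gained in \<open>adm_verify\<close> makes
    these payments add up to \<open>verify_cost * (total_rate n j y - 1)\<close>.\<close>
  have e3: "adm (\<lambda>x y. \<Sum>c\<in>col. of_bool (marked x \<noteq> j \<and> leaf x j = c) * 1 *
        (if x c = y c then case target (x c) of None \<Rightarrow> 0 | Some b \<Rightarrow> of_bool (marked x = b) else 0))
     (\<lambda>x. \<Sum>c\<in>col. (of_bool (marked x \<noteq> j \<and> leaf x j = c))\<^sup>2 * (case target (x c) of None \<Rightarrow> 0 | Some b \<Rightarrow> verify_cost))
     (\<lambda>y. \<Sum>c\<in>col. 1\<^sup>2 * (case target (y c) of None \<Rightarrow> 0 | Some b \<Rightarrow> verify_cost / wt n b y))"
    by (rule adm_sum[OF fin]) (rule adm_jump[OF sub adm_verify])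
  show ?thesis
  proof (rule adm_mono[OF adm_add[OF adm_verify[OF j] adm_add[OF adm_rescale[OF e2 sn] e3]]])
    fix x y assume xy: "x \<in> pos" "y \<in> neg"
    have "(\<Sum>c\<in>col. of_bool (marked x \<noteq> j \<and> leaf x j = c) * 1 *
        (if x c = y c then case target (x c) of None \<Rightarrow> 0 | Some b \<Rightarrow> of_bool (marked x = b) else 0))
        = (of_bool (marked x \<noteq> j \<and> x (leaf x j) = y (leaf x j)) :: real)"
    proof (cases "marked x \<noteq> j")
      case True
      then show ?thesis using lf(2)[OF xy(1) True] by (subst sum_single[OF fin lf(1)[OF xy(1) True]]) auto
    qed simp
    then show "1 = of_bool (marked x = j) + (of_bool (marked x \<noteq> j \<and> x (leaf x j) \<noteq> y (leaf x j)) +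
      (\<Sum>c\<in>col. of_bool (marked x \<noteq> j \<and> leaf x j = c) * 1 *
        (if x c = y c then case target (x c) of None \<Rightarrow> 0 | Some b \<Rightarrow> of_bool (marked x = b) else 0)) :: real)"
      by auto
  next
    fix x assume "x \<in> pos"
    have "(\<Sum>c\<in>col. (of_bool (marked x \<noteq> j \<and> leaf x j = c))\<^sup>2 * (case target (x c) of None \<Rightarrow> 0 | Some b \<Rightarrow> verify_cost))
      \<le> (\<Sum>c\<in>col. of_bool (marked x \<noteq> j \<and> leaf x j = c) * verify_cost)"
      by (rule sum_mono) (use verify_cost_nonneg in \<open>auto split: option.split\<close>)
    also have "\<dots> \<le> 1 * verify_cost"
      unfolding sum_distrib_right[symmetric] by (rule mult_right_mono[OF sel verify_cost_nonneg])
    finally show "verify_cost + (sqrt n * (1 * 1) + (\<Sum>c\<in>col. (of_bool (marked x \<noteq> j \<and> leaf x j = c))\<^sup>2 *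
      (case target (x c) of None \<Rightarrow> 0 | Some b \<Rightarrow> verify_cost))) \<le> direct_cost"
      by (simp add: direct_cost_def)
  next
    fix y
    have "(\<Sum>c\<in>col. 1\<^sup>2 * (case target (y c) of None \<Rightarrow> 0 | Some b \<Rightarrow> verify_cost / wt n b y))
      = verify_cost * (total_rate n j y - 1)"
      unfolding total_rate_def col_def[symmetric] add_diff_cancel_left' sum_distrib_left
      by (intro sum.cong) (auto simp: rate_def split: option.split)
    moreover have "verify_cost / wt n j y \<le> verify_cost"
      using verify_cost_nonneg wt_ge_1[of n j y] by (simp add: divide_le_eq mult_left_le mult_le_cancel_left1)
    moreover have "direct_cost * total_rate n j y = 2 * verify_cost * total_rate n j y + sqrt n * total_rate n j y"
      by (simp add: direct_cost_def algebra_simps)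
    moreover have "sqrt n * 1 \<le> sqrt n * total_rate n j y" using total_rate_ge_1 by (intro mult_left_mono) auto
    moreover have "verify_cost * 1 \<le> verify_cost * total_rate n j y"
      using total_rate_ge_1 verify_cost_nonneg by (intro mult_left_mono) auto
    ultimately show "verify_cost / wt n j y + (real n * 1 / sqrt n + (\<Sum>c\<in>col. 1\<^sup>2 *
       (case target (y c) of None \<Rightarrow> 0 | Some b \<Rightarrow> verify_cost / wt n b y))) \<le> direct_cost * total_rate n j y"
      using div_sqrt(1) verify_cost_nonneg by (simp add: algebra_simps)
  qed
qed

text \<open>One step of the walk. With \<open>R = total_rate n j\<close> and \<open>G x y\<close> the sum of \<open>2 / (wt n b x + wt n b y)\<close> over the cells of
  column \<open>j\<close> on which \<open>x\<close> and \<open>y\<close> agree and which point to \<open>b\<close>,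
  \<open>(R x + R y) / 2 = ((R x + R y) / 2 - 1 - G x y) + (1 + G x y)\<close>. The first summand vanishes on the diagonal and is
  cheap; in the second one, the \<open>1\<close> is a stop (direct verification) and each term of \<open>G\<close> moves to column \<open>b\<close>.\<close>

lemma adm_step:
  assumes j: "j \<in> {1..m}" and D: "\<And>b. b \<in> {1..m} \<Longrightarrow> adm (\<lambda>_ _. 1) (D b) (D b)"
  defines "E \<equiv> \<lambda>x. (5 * sqrt n + direct_cost) + (\<Sum>c\<in>column n j. case target (x c) of None \<Rightarrow> 0 | Some b \<Rightarrow> D b x / wt n b x) / total_rate n j x"
  shows "adm (\<lambda>_ _. 1) E E"
proof -
  define col where "col = column n j"
  have fin: "finite col" and card: "card col = n" by (simp_all add: col_def)
  have sub: "c \<in> cells n m" if "c \<in> col" for c using that column_subset[OF j] by (auto simp: col_def)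
  have sn: "sqrt n > 0" using n by simp
  define R where "R = total_rate n j"
  define r where "r c x = rate n (x c) x" for c x
  have R: "R x = 1 + (\<Sum>c\<in>col. r c x)" for x by (simp add: R_def total_rate_def col_def r_def)
  have R1: "R x \<ge> 1" for x using total_rate_ge_1 by (simp add: R_def)
  have R0: "R x > 0" for x using R1[of x] by simp
  have rb: "0 \<le> r c x" "r c x \<le> 1" for c x using rate_bounds by (auto simp: r_def)
  have r2: "(\<Sum>c\<in>col. (r c x)\<^sup>2 * 1) \<le> R x - 1" for x
    unfolding R by (simp, rule sum_mono) (use rb in \<open>simp add: power2_eq_square mult_left_le\<close>)
  have query: "adm (\<lambda>x y. if x c = y c then 0 else 1) (\<lambda>_. 1) (\<lambda>_. 1)" if "c \<in> col" for c
    by (rule adm_query) (rule sub[OF that])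
  \<comment> \<open>Twice the first summand, \<open>R x + R y - 2 - 2 * G x y\<close>, is split by
    cells. Where the inputs disagree the contribution is \<open>r c x + r c y\<close>
    (\<open>m1\<close>, \<open>m2\<close>); where they agree it is the kernel of
    \<open>adm_inverse_count\<close> (\<open>m3\<close>). The bound \<open>r c x \<le> 1\<close>
    makes the weighted side cost \<open>R - 1\<close> instead of \<open>n\<close>.\<close>
  have m1: "adm (\<lambda>x y. \<Sum>c\<in>col. r c x * 1 * (if x c = y c then 0 else 1))
      (\<lambda>x. \<Sum>c\<in>col. (r c x)\<^sup>2 * 1) (\<lambda>y. \<Sum>c\<in>col. 1\<^sup>2 * 1)"
    by (rule adm_sum[OF fin query])
  have m2: "adm (\<lambda>x y. \<Sum>c\<in>col. 1 * r c y * (if x c = y c then 0 else 1))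
      (\<lambda>x. \<Sum>c\<in>col. 1\<^sup>2 * 1) (\<lambda>y. \<Sum>c\<in>col. (r c y)\<^sup>2 * 1)"
    by (rule adm_sum[OF fin query])
  have cnt: "adm (\<lambda>x y. 1 / wt n b x + 1 / wt n b y - 4 / (wt n b x + wt n b y))
       (\<lambda>x. 4 * sqrt n / wt n b x) (\<lambda>y. 4 * sqrt n / wt n b y)" if "b \<in> {1..m}" for b
    by (rule adm_inverse_count[where R = "column n b" and P = "\<lambda>s. \<not> sval s"])
       (use column_subset[OF that] n in \<open>auto simp: wt_def\<close>)
  define jd where "jd c x y = (if x c = y c then case target (x c) of None \<Rightarrow> 0
      | Some b \<Rightarrow> 1 / wt n b x + 1 / wt n b y - 4 / (wt n b x + wt n b y) else 0)" for c x y
  define jm where "jm c x y = (if x c = y c then case target (x c) of None \<Rightarrow> 0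
      | Some b \<Rightarrow> 2 * 1 / (wt n b x + wt n b y) else 0)" for c x y
  have m3: "adm (\<lambda>x y. \<Sum>c\<in>col. 1 * 1 * jd c x y)
      (\<lambda>x. \<Sum>c\<in>col. 1\<^sup>2 * (case target (x c) of None \<Rightarrow> 0 | Some b \<Rightarrow> 4 * sqrt n / wt n b x))
      (\<lambda>x. \<Sum>c\<in>col. 1\<^sup>2 * (case target (x c) of None \<Rightarrow> 0 | Some b \<Rightarrow> 4 * sqrt n / wt n b x))"
    unfolding jd_def by (rule adm_sum[OF fin]) (rule adm_jump[OF sub cnt])
  define M where "M x = (\<Sum>c\<in>col. case target (x c) of None \<Rightarrow> 0 | Some b \<Rightarrow> D b x / wt n b x)" for x
  have m4: "adm (\<lambda>x y. \<Sum>c\<in>col. 1 * 1 * jm c x y)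
      (\<lambda>x. \<Sum>c\<in>col. 1\<^sup>2 * (case target (x c) of None \<Rightarrow> 0 | Some b \<Rightarrow> D b x / wt n b x))
      (\<lambda>x. \<Sum>c\<in>col. 1\<^sup>2 * (case target (x c) of None \<Rightarrow> 0 | Some b \<Rightarrow> D b x / wt n b x))"
    unfolding jm_def
  proof (rule adm_sum[OF fin], rule adm_jump[OF sub])
    fix b assume "b \<in> {1..m}"
    then show "adm (\<lambda>x y. 2 * 1 / (wt n b x + wt n b y)) (\<lambda>x. D b x / wt n b x) (\<lambda>y. D b y / wt n b y)"
      by (intro adm_cauchy[OF D]) (use wt_ge_1 in \<open>auto intro: less_le_trans[OF zero_less_one]\<close>)
  qed
  have s3: "(\<Sum>c\<in>col. 1\<^sup>2 * (case target (x c) of None \<Rightarrow> 0 | Some b \<Rightarrow> 4 * sqrt n / wt n b x)) = 4 * sqrt n * (R x - 1)" for x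
    unfolding R add_diff_cancel_left' sum_distrib_left
    by (intro sum.cong) (auto simp: r_def rate_def split: option.split)
  have sr: "sqrt n * (\<Sum>c\<in>col. (r c x)\<^sup>2 * 1) \<le> sqrt n * (R x - 1)" for x
    using r2 by (intro mult_left_mono) auto
  have sumM: "sqrt n * (\<Sum>c\<in>col. (r c x)\<^sup>2 * 1) + sqrt n +
      (\<Sum>c\<in>col. 1\<^sup>2 * (case target (x c) of None \<Rightarrow> 0 | Some b \<Rightarrow> 4 * sqrt n / wt n b x)) \<le> 5 * sqrt n * R x" for x
  proof -
    have "4 * sqrt n * (R x - 1) = 4 * (sqrt n * R x) - 4 * sqrt n" "sqrt n * (R x - 1) = sqrt n * R x - sqrt n"
      "5 * sqrt n * R x = 5 * (sqrt n * R x)" by (simp_all add: algebra_simps)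
    then show ?thesis using sr[of x] sn unfolding s3 by linarith
  qed
  have M: "adm (\<lambda>x y. ((\<Sum>c\<in>col. r c x * 1 * (if x c = y c then 0 else 1)) + (\<Sum>c\<in>col. 1 * r c y * (if x c = y c then 0 else 1)))
      + (\<Sum>c\<in>col. 1 * 1 * jd c x y)) (\<lambda>x. 5 * sqrt n * R x) (\<lambda>x. 5 * sqrt n * R x)"
    by (rule adm_mono[OF adm_add[OF adm_add[OF adm_rescale[OF m1 sn] adm_rescale[OF m2, where s = "1 / sqrt n"]] m3]])
       (use sumM sn card div_sqrt in \<open>simp_all add: add_ac mult_ac\<close>)
  have half: "adm (\<lambda>x y. ((R x + R y) / 2 - 1) - (\<Sum>c\<in>col. jm c x y)) (\<lambda>x. 5 * sqrt n * R x) (\<lambda>x. 5 * sqrt n * R x)"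
  proof (rule adm_mono[OF adm_mult[OF M, where \<alpha> = "\<lambda>_. 1 / 2" and \<beta> = "\<lambda>_. 1"]])
    fix x y
    have halve: "a + b - 2 - 2 * d = t \<Longrightarrow> (a + b) / 2 - 1 - d = 1 / 2 * 1 * t" for a b d t :: real
      by (simp add: field_simps)
    have "(R x + R y) - 2 - 2 * (\<Sum>c\<in>col. jm c x y) = (\<Sum>c\<in>col. r c x + r c y - 2 * jm c x y)"
      unfolding R by (simp add: sum.distrib sum_subtractf sum_distrib_left)
    also have "\<dots> = (\<Sum>c\<in>col. (r c x * 1 * (if x c = y c then 0 else 1) + 1 * r c y * (if x c = y c then 0 else 1)) + 1 * 1 * jd c x y)"
      by (intro sum.cong) (auto simp: jm_def jd_def r_def rate_def split: option.split)
    also have "\<dots> = (\<Sum>c\<in>col. r c x * 1 * (if x c = y c then 0 else 1)) + (\<Sum>c\<in>col. 1 * r c y * (if x c = y c then 0 else 1))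
      + (\<Sum>c\<in>col. 1 * 1 * jd c x y)" by (simp only: sum.distrib)
    finally show "((R x + R y) / 2 - 1) - (\<Sum>c\<in>col. jm c x y) = 1 / 2 * 1 *
       (((\<Sum>c\<in>col. r c x * 1 * (if x c = y c then 0 else 1)) + (\<Sum>c\<in>col. 1 * r c y * (if x c = y c then 0 else 1)))
      + (\<Sum>c\<in>col. 1 * 1 * jd c x y))" by (rule halve)
  next
    fix x
    have "5 * sqrt n * R x \<ge> 0" using R0[of x] by simp
    then show "(1 / 2)\<^sup>2 * (5 * sqrt n * R x) \<le> 5 * sqrt n * R x" by (simp add: power2_eq_square)
  qed simp
  have direct: "adm (\<lambda>_ _. 1) (\<lambda>x. direct_cost * R x) (\<lambda>x. direct_cost * R x)"
    by (rule adm_mono[OF adm_direct[OF j]])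
       (use direct_cost_nonneg R1 in \<open>auto simp: R_def mult_le_cancel_left1\<close>)
  \<comment> \<open>Division by the mean of \<open>R x\<close> and \<open>R y\<close> yields the
    constant kernel 1 and divides each cost by its own \<open>R\<close>, so that every
    \<open>1 / wt\<close> becomes a transition probability of that input's own walk.\<close>
  have "adm (\<lambda>x y. 2 * ((((R x + R y) / 2 - 1) - (\<Sum>c\<in>col. jm c x y)) + (1 + (\<Sum>c\<in>col. 1 * 1 * jm c x y))) / (R x + R y))
     (\<lambda>x. (5 * sqrt n * R x + (direct_cost * R x + (\<Sum>c\<in>col. 1\<^sup>2 * (case target (x c) of None \<Rightarrow> 0 | Some b \<Rightarrow> D b x / wt n b x)))) / R x)
     (\<lambda>x. (5 * sqrt n * R x + (direct_cost * R x + (\<Sum>c\<in>col. 1\<^sup>2 * (case target (x c) of None \<Rightarrow> 0 | Some b \<Rightarrow> D b x / wt n b x)))) / R x)"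
    by (rule adm_cauchy[OF adm_add[OF half adm_add[OF direct m4]] R0])
  moreover have "(5 * sqrt n * R x + (direct_cost * R x + (\<Sum>c\<in>col. 1\<^sup>2 * (case target (x c) of None \<Rightarrow> 0 | Some b \<Rightarrow> D b x / wt n b x)))) / R x = E x" for x
    using R0[of x] unfolding E_def R_def[symmetric] col_def[symmetric] by (simp add: field_simps)
  moreover have "2 * ((((R x + R y) / 2 - 1) - (\<Sum>c\<in>col. jm c x y)) + (1 + (\<Sum>c\<in>col. 1 * 1 * jm c x y))) / (R x + R y) = 1" for x y
    using R0[of x] R0[of y] by (simp add: field_simps)
  ultimately show ?thesis by simp
qed

text \<open>The final 1 is slack by which each further step lowers the remainder term of
  \<open>adm_walk\<close>.\<close>

definition step_cost :: real where
  "step_cost = 5 * sqrt n + direct_cost + 1"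

lemma step_cost_ge_1: "step_cost \<ge> 1"
  using direct_cost_nonneg by (simp add: step_cost_def)

text \<open>Supermartingale inequality: from a column with \<open>w - 1\<close> zeros the walk stops with weight \<open>1\<close> and moves
  to a column with \<open>v - 1\<close> zeros with weight \<open>1 / v\<close>; then \<open>2 + ln w\<close> bounds the expected number of steps
  because \<open>1 + ln (v / w) \<le> v / w\<close>.\<close>

lemma potential_step:
  shows "total_rate n j x + (\<Sum>c\<in>column n j. case target (x c) of None \<Rightarrow> 0 | Some b \<Rightarrow> (2 + ln (wt n b x)) / wt n b x)
    \<le> (2 + ln (wt n j x)) * total_rate n j x"
proof -
  define w where "w = wt n j x"
  have w1: "w \<ge> 1" using wt_ge_1 by (simp add: w_def)
  have fin: "finite (column n j)" by simp
  \<comment> \<open>Each zero cell contributes an excess of at most \<open>1 / w\<close> over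
    \<open>(1 + ln w) * rate\<close>. There are \<open>w - 1\<close> zero cells, so the total excess
    stays below 1, the weight of stopping.\<close>
  have "(\<Sum>c\<in>column n j. case target (x c) of None \<Rightarrow> 0 | Some b \<Rightarrow> (2 + ln (wt n b x)) / wt n b x)
     \<le> (\<Sum>c\<in>column n j. (1 + ln w) * rate n (x c) x + of_bool (\<not> sval (x c)) / w)"
  proof (rule sum_mono)
    fix c
    show "(case target (x c) of None \<Rightarrow> 0 | Some b \<Rightarrow> (2 + ln (wt n b x)) / wt n b x)
       \<le> (1 + ln w) * rate n (x c) x + of_bool (\<not> sval (x c)) / w"
    proof (cases "target (x c)")
      case None
      then show ?thesis using w1 by (simp add: rate_def)
    next
      case (Some b)
      define v where "v = wt n b x"
      have v: "v \<ge> 1" using wt_ge_1 by (simp add: v_def)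
      have "ln (v / w) \<le> v / w - 1" using v w1 by (intro ln_le_minus_one) auto
      then have "2 + ln v \<le> 1 + ln w + v / w" using v w1 by (simp add: ln_div)
      then have "(2 + ln v) / v \<le> (1 + ln w + v / w) / v" using v by (intro divide_right_mono) auto
      also have "\<dots> = (1 + ln w) * (1 / v) + 1 / w" using v w1 by (simp add: field_simps)
      finally show ?thesis using Some by (auto simp: rate_def v_def target_def split: if_splits)
    qed
  qed
  also have "\<dots> = (1 + ln w) * (\<Sum>c\<in>column n j. rate n (x c) x) + (\<Sum>c\<in>column n j. of_bool (\<not> sval (x c))) / w"
    by (simp only: sum.distrib sum_distrib_left sum_divide_distrib)
  also have "\<dots> = (1 + ln w) * (total_rate n j x - 1) + (w - 1) / w"
    by (simp only: total_rate_def w_def wt_def add_diff_cancel_left')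
  finally have "(\<Sum>c\<in>column n j. case target (x c) of None \<Rightarrow> 0 | Some b \<Rightarrow> (2 + ln (wt n b x)) / wt n b x)
     \<le> (1 + ln w) * (total_rate n j x - 1) + (w - 1) / w" .
  moreover have "(w - 1) / w \<le> 1" "ln w \<ge> 0" using w1 by simp_all
  ultimately show ?thesis by (simp add: w_def[symmetric] algebra_simps)
qed

text \<open>The walk may revisit columns, so it is cut off after \<open>k\<close> steps, where
  \<open>adm_direct\<close> is used whatever its cost. That cost is at most
  \<open>direct_cost * (1 + real n)\<close>; it appears as the remainder, which decreases by 1 per
  step until it is 0. The potential term does not grow with \<open>k\<close>.\<close>

lemma adm_walk:
  assumes "j \<in> {1..m}"
  shows "adm (\<lambda>_ _. 1)
    (\<lambda>x. step_cost * (2 + ln (wt n j x)) + max 0 (direct_cost * (1 + real n) - real k))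
    (\<lambda>x. step_cost * (2 + ln (wt n j x)) + max 0 (direct_cost * (1 + real n) - real k))"
  using assms
proof (induction k arbitrary: j)
  case 0
  have nn: "step_cost * (2 + ln (wt n j x)) \<ge> 0" for x
    using step_cost_ge_1 wt_ge_1[of n j x] by (intro mult_nonneg_nonneg) (auto simp: add_nonneg_nonneg)
  show ?case
  proof (rule adm_mono[OF adm_direct[OF 0]])
    fix x
    have "direct_cost * 1 \<le> direct_cost * (1 + real n)" "direct_cost * total_rate n j x \<le> direct_cost * (1 + real n)"
      using direct_cost_nonneg total_rate_le by (intro mult_left_mono; simp)+
    then show "direct_cost \<le> step_cost * (2 + ln (wt n j x)) + max 0 (direct_cost * (1 + real n) - real 0)"
      "direct_cost * total_rate n j x \<le> step_cost * (2 + ln (wt n j x)) + max 0 (direct_cost * (1 + real n) - real 0)"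
      using nn[of x] by auto
  qed simp
next
  case (Suc k)
  define e where "e = max 0 (direct_cost * (1 + real n) - real k)"
  define e' where "e' = max 0 (direct_cost * (1 + real n) - real (Suc k))"
  have e: "e \<ge> 0" "e' \<ge> e - 1" by (auto simp: e_def e'_def)
  let ?V = "\<lambda>j x. step_cost * (2 + ln (wt n j x)) + e"
  have bound: "(5 * sqrt n + direct_cost) + (\<Sum>c\<in>column n j. case target (x c) of None \<Rightarrow> 0 | Some b \<Rightarrow> ?V b x / wt n b x) / total_rate n j x
       \<le> step_cost * (2 + ln (wt n j x)) + e'" for x
  proof -
    define R where "R = total_rate n j x"
    have R1: "R \<ge> 1" using total_rate_ge_1 by (simp add: R_def)
    define P where "P = (\<Sum>c\<in>column n j. case target (x c) of None \<Rightarrow> 0 | Some b \<Rightarrow> (2 + ln (wt n b x)) / wt n b x)"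
    have "(\<Sum>c\<in>column n j. case target (x c) of None \<Rightarrow> 0 | Some b \<Rightarrow> ?V b x / wt n b x)
       = (\<Sum>c\<in>column n j. step_cost * (case target (x c) of None \<Rightarrow> 0 | Some b \<Rightarrow> (2 + ln (wt n b x)) / wt n b x)
            + e * rate n (x c) x)"
      by (intro sum.cong refl) (simp add: rate_def add_divide_distrib ring_distribs split: option.split)
    also have "\<dots> = step_cost * P + e * (R - 1)"
      by (simp add: sum.distrib P_def R_def total_rate_def sum_distrib_left)
    finally have S: "(\<Sum>c\<in>column n j. case target (x c) of None \<Rightarrow> 0 | Some b \<Rightarrow> ?V b x / wt n b x)
       = step_cost * P + e * (R - 1)" .
    have "step_cost * (R + P) \<le> step_cost * ((2 + ln (wt n j x)) * R)"
      using potential_step[of j x] step_cost_ge_1 by (intro mult_left_mono) (auto simp: P_def R_def)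
    moreover have "(e - 1) * R \<le> e' * R" using e R1 by (intro mult_right_mono) auto
    moreover have "(5 * sqrt n + direct_cost) * R = step_cost * R - R" by (simp add: step_cost_def algebra_simps)
    ultimately have "(5 * sqrt n + direct_cost) * R + (step_cost * P + e * (R - 1)) \<le> (step_cost * (2 + ln (wt n j x)) + e') * R"
      using e by (simp add: algebra_simps)
    then have "((5 * sqrt n + direct_cost) * R + (step_cost * P + e * (R - 1))) / R \<le> step_cost * (2 + ln (wt n j x)) + e'"
      using R1 by (simp add: divide_le_eq)
    then show ?thesis unfolding S R_def[symmetric] using R1 by (simp add: add_divide_distrib)
  qed
  show ?case
    by (rule adm_mono[OF adm_step[OF Suc.prems Suc.IH]]) (use bound[unfolded e_def e'_def] in simp_all)
qed

definition total_cost :: real where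
  "total_cost = step_cost * (2 + ln (1 + real n))"

lemma adm_total: "adm (\<lambda>_ _. 1) (\<lambda>_. total_cost) (\<lambda>_. total_cost)"
proof -
  \<comment> \<open>Enough steps for the remainder to vanish; their number has no influence on the
    cost.\<close>
  define k where "k = nat \<lceil>direct_cost * (1 + real n)\<rceil>"
  have k: "direct_cost * (1 + real n) \<le> real k" by (simp add: k_def real_nat_ceiling_ge)
  have "step_cost * (2 + ln (wt n 1 x)) \<le> total_cost" for x
    unfolding total_cost_def using step_cost_ge_1 wt_le[of n 1 x] wt_ge_1[of n 1 x]
    by (intro mult_left_mono) auto
  then show ?thesis
    by (intro adm_mono[OF adm_walk[of 1 k]]) (use m k in auto)
qed

end

section \<open>Gram matrices and orthogonal maps\<close>

definition dot :: "nat \<Rightarrow> (nat \<Rightarrow> real) \<Rightarrow> (nat \<Rightarrow> real) \<Rightarrow> real" where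
  "dot D a b = (\<Sum>i<D. a i * b i)"

definition rmul :: "nat \<Rightarrow> (nat \<Rightarrow> nat \<Rightarrow> real) \<Rightarrow> (nat \<Rightarrow> real) \<Rightarrow> nat \<Rightarrow> real" where
  "rmul D U v = (\<lambda>i. if i < D then (\<Sum>k<D. U i k * v k) else 0)"

text \<open>Rows are what \<open>unitary_mat\<close> asks for and columns are what preserves inner
  products; requiring both avoids deriving one from the other.\<close>

definition orth :: "nat \<Rightarrow> (nat \<Rightarrow> nat \<Rightarrow> real) \<Rightarrow> bool" where
  "orth D U \<longleftrightarrow> (\<forall>i<D. \<forall>j<D. (\<Sum>k<D. U i k * U j k) = of_bool (i = j)) \<and>
                (\<forall>i<D. \<forall>j<D. (\<Sum>k<D. U k i * U k j) = of_bool (i = j))"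

lemma dot_cong: "(\<And>i. i < D \<Longrightarrow> a i = a' i) \<Longrightarrow> (\<And>i. i < D \<Longrightarrow> b i = b' i) \<Longrightarrow> dot D a b = dot D a' b'"
  by (simp add: dot_def)

lemma dot_commute: "dot D a b = dot D b a"
  by (simp add: dot_def mult.commute)

lemma dot_diff: "dot D (\<lambda>i. a i - b i) c = dot D a c - dot D b c"
  by (simp add: dot_def left_diff_distrib sum_subtractf)

lemma dot_self_eq_0: "dot D a a = 0 \<longleftrightarrow> (\<forall>i<D. a i = 0)"
  unfolding dot_def by (subst sum_nonneg_eq_0_iff) auto

lemma rmul_cong: "(\<And>i. i < D \<Longrightarrow> a i = b i) \<Longrightarrow> rmul D U a = rmul D U b"
  by (auto simp: rmul_def)

lemma rmul_diff: "i < D \<Longrightarrow> rmul D U a i - rmul D U b i = rmul D U (\<lambda>i. a i - b i) i"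
  by (simp add: rmul_def right_diff_distrib sum_subtractf)

lemma dot_rmul:
  assumes "orth D U"
  shows "dot D (rmul D U a) (rmul D U b) = dot D a b"
proof -
  have "dot D (rmul D U a) (rmul D U b) = (\<Sum>i<D. \<Sum>k<D. \<Sum>l<D. (a k * b l) * (U i k * U i l))"
    by (simp add: dot_def rmul_def sum_product mult_ac)
  also have "\<dots> = (\<Sum>k<D. \<Sum>i<D. \<Sum>l<D. (a k * b l) * (U i k * U i l))"
    by (rule sum.swap)
  also have "\<dots> = (\<Sum>k<D. \<Sum>l<D. \<Sum>i<D. (a k * b l) * (U i k * U i l))"
    by (intro sum.cong refl sum.swap)
  also have "\<dots> = (\<Sum>k<D. \<Sum>l<D. of_bool (k = l) * (a k * b l))"
    using assms by (intro sum.cong refl) (simp add: orth_def flip: sum_distrib_left)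
  also have "\<dots> = (\<Sum>k<D. a k * b k)"
    by (intro sum.cong refl) (rule sum_of_bool_single, auto)
  finally show ?thesis by (simp add: dot_def)
qed

lemma orth_columns:
  assumes "orth D U" "orth D V" "i < D" "j < D"
  shows "(\<Sum>k<D. (\<Sum>l<D. U k l * V l i) * (\<Sum>l<D. U k l * V l j)) = of_bool (i = j)"
proof -
  have "(\<Sum>k<D. (\<Sum>l<D. U k l * V l i) * (\<Sum>l<D. U k l * V l j))
      = dot D (rmul D U (\<lambda>l. V l i)) (rmul D U (\<lambda>l. V l j))"
    by (simp add: dot_def rmul_def)
  then show ?thesis using assms by (simp only: dot_rmul) (simp add: dot_def orth_def)
qed

lemma orth_mult:
  assumes "orth D U" "orth D V"
  shows "orth D (\<lambda>i j. \<Sum>k<D. U i k * V k j)"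
proof -
  have t: "orth D (\<lambda>i j. V j i)" "orth D (\<lambda>i j. U j i)" using assms by (auto simp: orth_def)
  show ?thesis
    unfolding orth_def using orth_columns[OF assms] orth_columns[OF t] by (simp add: mult.commute)
qed

lemma rmul_mult: "rmul D (\<lambda>i j. \<Sum>k<D. U i k * V k j) v = rmul D U (rmul D V v)"
proof
  fix i
  have "(\<Sum>j<D. (\<Sum>k<D. U i k * V k j) * v j) = (\<Sum>k<D. \<Sum>j<D. U i k * V k j * v j)"
    unfolding sum_distrib_right by (rule sum.swap)
  also have "\<dots> = (\<Sum>k<D. U i k * rmul D V v k)"
    by (intro sum.cong refl) (simp add: rmul_def sum_distrib_left mult_ac)
  finally show "rmul D (\<lambda>i j. \<Sum>k<D. U i k * V k j) v i = rmul D U (rmul D V v) i"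
    by (simp add: rmul_def)
qed

lemma orth_id: "orth D (\<lambda>i j. of_bool (i = j))"
  unfolding orth_def by (auto simp: sum_of_bool_single)

lemma rmul_id: "i < D \<Longrightarrow> rmul D (\<lambda>i j. of_bool (i = j)) v i = v i"
  by (simp add: rmul_def sum_of_bool_single)

text \<open>Reflection in the hyperplane orthogonal to \<open>a - b\<close>. With equal norms it
  exchanges \<open>a\<close> and \<open>b\<close>, and it fixes every \<open>v\<close> orthogonal to
  \<open>a - b\<close>.\<close>

lemma householder:
  assumes "dot D a a = dot D b b"
  obtains H where "orth D H" "\<And>i. i < D \<Longrightarrow> rmul D H a i = b i"
    "\<And>v i. dot D v a = dot D v b \<Longrightarrow> i < D \<Longrightarrow> rmul D H v i = v i"
proof -
  define h where "h i = a i - b i" for i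
  show ?thesis
  proof (cases "dot D h h = 0")
    case True
    then have "\<forall>i<D. a i = b i" by (auto simp: dot_self_eq_0 h_def)
    then show ?thesis using that[OF orth_id] by (auto simp: rmul_id)
  next
    case False
    define s where "s = dot D h h"
    have s: "s \<noteq> 0" using False by (simp add: s_def)
    define H where "H i j = of_bool (i = j) - 2 * h i * h j / s" for i j
    have Hv: "rmul D H v i = v i - 2 * dot D h v / s * h i" if "i < D" for v i
    proof -
      have "rmul D H v i = (\<Sum>k<D. H i k * v k)" using that by (simp add: rmul_def)
      also have "\<dots> = (\<Sum>k<D. of_bool (i = k) * v k - 2 * h i / s * (h k * v k))"
        by (intro sum.cong refl) (simp add: H_def algebra_simps)
      also have "\<dots> = (\<Sum>k<D. of_bool (i = k) * v k) - (\<Sum>k<D. 2 * h i / s * (h k * v k))"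
        by (rule sum_subtractf)
      finally have "rmul D H v i = (\<Sum>k<D. of_bool (i = k) * v k) - (\<Sum>k<D. 2 * h i / s * (h k * v k))" .
      moreover have "(\<Sum>k<D. 2 * h i / s * (h k * v k)) = 2 * h i / s * dot D h v"
        by (simp only: dot_def sum_distrib_left)
      ultimately show ?thesis using that by (simp add: sum_of_bool_single)
    qed
    have row: "(\<Sum>k<D. H i k * H j k) = of_bool (i = j)" if "i < D" "j < D" for i j
    proof -
      have "(\<Sum>k<D. H i k * H j k) = rmul D H (H j) i" using that by (simp add: rmul_def)
      also have "\<dots> = H j i - 2 * dot D h (H j) / s * h i" by (rule Hv[OF that(1)])
      also have "dot D h (H j) = rmul D H h j" using that by (simp add: dot_def rmul_def mult.commute)
      also have "\<dots> = - h j" using Hv[OF that(2), of h] s by (simp add: s_def[symmetric])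
      finally show ?thesis by (auto simp: H_def)
    qed
    have sym: "H i j = H j i" for i j by (simp add: H_def eq_commute mult_ac)
    have orthH: "orth D H" unfolding orth_def using row sym by simp
    have s2: "s = 2 * dot D h a"
    proof -
      have "s = dot D a h - dot D b h" unfolding s_def by (subst h_def[abs_def], rule dot_diff)
      moreover have "dot D a h = dot D a a - dot D b a" "dot D b h = dot D a b - dot D b b"
        unfolding dot_commute[of D a h] dot_commute[of D b h] unfolding h_def by (rule dot_diff)+
      moreover have "dot D h a = dot D a a - dot D b a" unfolding h_def by (rule dot_diff)
      ultimately show ?thesis using assms dot_commute[of D a b] by simp
    qed
    show ?thesis
    proof (rule that[OF orthH])
      fix i assume "i < D"
      then show "rmul D H a i = b i" using Hv[of i a] s s2 by (simp add: h_def)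
    next
      fix v i assume "dot D v a = dot D v b" and i: "i < D"
      then have "dot D h v = 0" unfolding h_def dot_diff by (simp add: dot_commute)
      then show "rmul D H v i = v i" using Hv[OF i, of v] by simp
    qed
  qed
qed

text \<open>Vectors are matched one at a time. The next reflection sends the image of
  \<open>a s\<close> to \<open>b s\<close>; equality of the Gram matrices says that every
  \<open>b x\<close> matched so far is orthogonal to the difference of these two, so it stays in
  place.\<close>

lemma gram_imp_orthogonal:
  assumes "finite X" "\<And>x y. x \<in> X \<Longrightarrow> y \<in> X \<Longrightarrow> dot D (a x) (a y) = dot D (b x) (b y)"
  shows "\<exists>U. orth D U \<and> (\<forall>x\<in>X. \<forall>i<D. rmul D U (a x) i = b x i)"
  using assms
proof (induction X rule: finite_induct)
  case empty
  show ?case using orth_id by auto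
next
  case (insert s X)
  then obtain U where U: "orth D U" "\<And>x i. x \<in> X \<Longrightarrow> i < D \<Longrightarrow> rmul D U (a x) i = b x i" by auto
  have "dot D (rmul D U (a s)) (rmul D U (a s)) = dot D (b s) (b s)"
    using insert.prems by (simp add: dot_rmul[OF U(1)])
  then obtain H where H: "orth D H" "\<And>i. i < D \<Longrightarrow> rmul D H (rmul D U (a s)) i = b s i"
    "\<And>v i. dot D v (rmul D U (a s)) = dot D v (b s) \<Longrightarrow> i < D \<Longrightarrow> rmul D H v i = v i"
    by (rule householder) blast
  define V where "V i j = (\<Sum>k<D. H i k * U k j)" for i j
  have V: "rmul D V v = rmul D H (rmul D U v)" for v unfolding V_def by (rule rmul_mult)
  have "rmul D V (a x) i = b x i" if x: "x \<in> insert s X" and i: "i < D" for x i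
  proof (cases "x = s")
    case True
    then show ?thesis using H(2) i by (simp add: V)
  next
    case False
    then have x: "x \<in> X" using x by simp
    have "dot D (rmul D U (a x)) (rmul D U (a s)) = dot D (b x) (b s)"
      using insert.prems x by (simp add: dot_rmul[OF U(1)])
    also have "\<dots> = dot D (rmul D U (a x)) (b s)" using U(2)[OF x] by (intro dot_cong) auto
    finally show ?thesis using H(3) U(2)[OF x i] i by (simp add: V)
  qed
  moreover have "orth D V" unfolding V_def by (rule orth_mult[OF H(1) U(1)])
  ultimately show ?case by blast
qed

lemma unitary_of_real: "orth D U \<Longrightarrow> unitary_mat D (\<lambda>i j. complex_of_real (U i j))"
  by (auto simp: orth_def unitary_mat_def simp flip: of_real_mult of_real_sum)

lemma apply_mat_of_real:
  "apply_mat D (\<lambda>i j. complex_of_real (U i j)) (\<lambda>i. complex_of_real (v i)) = (\<lambda>i. complex_of_real (rmul D U v i))"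
  by (auto simp: apply_mat_def rmul_def)

section \<open>The oracle and a run with real amplitudes\<close>

definition oracle_index :: "nat \<Rightarrow> nat \<Rightarrow> nat \<Rightarrow> (cell \<Rightarrow> sym) \<Rightarrow> nat \<Rightarrow> nat" where
  "oracle_index n m W x idx =
     (let S = sigma_size n m; w = idx mod W; p = (idx div W) mod S; cn = idx div (W * S);
          c = (cn div m + 1, cn mod m + 1); e = enc_sym n m (x c) mod S
      in (cn * S + (p + S - e) mod S) * W + w)"

definition roracle :: "nat \<Rightarrow> nat \<Rightarrow> nat \<Rightarrow> (cell \<Rightarrow> sym) \<Rightarrow> (nat \<Rightarrow> real) \<Rightarrow> nat \<Rightarrow> real" where
  "roracle n m W x v = (\<lambda>i. if i < qdim n m W then v (oracle_index n m W x i) else 0)"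

lemma oracle_apply_of_real:
  "oracle_apply n m W x (\<lambda>i. complex_of_real (v i)) = (\<lambda>i. complex_of_real (roracle n m W x v i))"
  by (auto simp: oracle_apply_def roracle_def oracle_index_def Let_def)

lemma run_alg_Cons:
  "run_alg n m W x (U # Us) v =
     fold (\<lambda>U' s. apply_mat (qdim n m W) U' (oracle_apply n m W x s)) Us (apply_mat (qdim n m W) U v)"
  by (induction Us arbitrary: U v) simp_all

primrec run_real :: "nat \<Rightarrow> nat \<Rightarrow> nat \<Rightarrow> (cell \<Rightarrow> sym) \<Rightarrow> (nat \<Rightarrow> nat \<Rightarrow> nat \<Rightarrow> real) \<Rightarrow> nat \<Rightarrow> nat \<Rightarrow> real" where
  "run_real n m W x U 0 = rmul (qdim n m W) (U 0) (\<lambda>i. if i = 0 then 1 else 0)"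
| "run_real n m W x U (Suc k) = rmul (qdim n m W) (U (Suc k)) (roracle n m W x (run_real n m W x U k))"

lemma run_alg_of_real:
  "run_alg n m W x (map (\<lambda>k i j. complex_of_real (U k i j)) [0..<Suc k]) init_state
     = (\<lambda>i. complex_of_real (run_real n m W x U k i))"
proof -
  have init: "init_state = (\<lambda>i. complex_of_real (if i = 0 then 1 else 0))" by (auto simp: init_state_def)
  have "fold (\<lambda>U' s. apply_mat (qdim n m W) U' (oracle_apply n m W x s))
      (map (\<lambda>k i j. complex_of_real (U k i j)) [1..<Suc k])
      (apply_mat (qdim n m W) (\<lambda>i j. complex_of_real (U 0 i j)) init_state)
    = (\<lambda>i. complex_of_real (run_real n m W x U k i))"
    by (induction k) (simp_all add: init apply_mat_of_real oracle_apply_of_real)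
  moreover have "map (\<lambda>k i j. complex_of_real (U k i j)) [0..<Suc k] =
      (\<lambda>i j. complex_of_real (U 0 i j)) # map (\<lambda>k i j. complex_of_real (U k i j)) [1..<Suc k]"
    by (subst upt_conv_Cons) simp_all
  ultimately show ?thesis by (simp only: run_alg_Cons)
qed

section \<open>The query space\<close>

definition cell_at :: "nat \<Rightarrow> nat \<Rightarrow> cell" where
  "cell_at m k = (k div m + 1, k mod m + 1)"

lemma mixed_radix_less:
  fixes a b :: nat
  assumes "a < A" "b < B"
  shows "a * B + b < A * B"
proof -
  have "a * B + b < a * B + B" using assms by simp
  also have "\<dots> = (a + 1) * B" by simp
  also have "\<dots> \<le> A * B" using assms by (intro mult_right_mono) auto
  finally show ?thesis .
qed

lemma bij_cell_at:
  assumes "m \<ge> 1"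
  shows "bij_betw (cell_at m) {..<n * m} (cells n m)"
proof (rule bij_betw_byWitness[where f' = "\<lambda>c. (fst c - 1) * m + (snd c - 1)"])
  show "cell_at m ` {..<n * m} \<subseteq> cells n m"
    using assms by (auto simp: cell_at_def cells_def Suc_le_eq less_mult_imp_div_less)
  show "(\<lambda>c. (fst c - 1) * m + (snd c - 1)) ` cells n m \<subseteq> {..<n * m}"
    using assms by (auto simp: cells_def intro!: mixed_radix_less)
qed (use assms in \<open>auto simp: cell_at_def cells_def\<close>)

lemma enc_cell_le:
  assumes "\<And>c. p = Some c \<Longrightarrow> c \<in> cells n m"
  shows "enc_cell m p \<le> n * m"
proof (cases p)
  case (Some c)
  obtain i j where c: "c = (i, j)" by (cases c)
  then have "i - 1 < n" "j - 1 < m" "j \<ge> 1" using assms Some by (auto simp: cells_def)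
  then have "(i - 1) * m + (j - 1) < n * m" by (intro mixed_radix_less)
  then show ?thesis using Some c \<open>j \<ge> 1\<close> by (simp add: enc_cell_def)
qed (simp add: enc_cell_def)

lemma enc_cell_inj:
  assumes "\<And>c. p = Some c \<Longrightarrow> c \<in> cells n m" "\<And>c. q = Some c \<Longrightarrow> c \<in> cells n m"
    and eq: "enc_cell m p = enc_cell m q"
  shows "p = q"
proof -
  have dec: "p = (if enc_cell m p = 0 then None else Some (cell_at m (enc_cell m p - 1)))"
    if "\<And>c. p = Some c \<Longrightarrow> c \<in> cells n m" for p
  proof (cases p)
    case (Some c)
    obtain i j where c: "c = (i, j)" by (cases c)
    then have b: "i \<ge> 1" "j \<ge> 1" "j - 1 < m" using that Some by (auto simp: cells_def)
    obtain i' j' where "i = Suc i'" "j = Suc j'" using b by (cases i; cases j) auto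
    then show ?thesis using Some c b by (simp add: enc_cell_def cell_at_def)
  qed (simp add: enc_cell_def)
  show ?thesis using dec[OF assms(1)] dec[OF assms(2)] eq by metis
qed

lemma mixed_radix_inj:
  fixes a b a' b' :: nat
  assumes "a + B * b = a' + B * b'" "a < B" "a' < B"
  shows "a = a'" "b = b'"
proof -
  show "a = a'" using arg_cong[OF assms(1), of "\<lambda>t. t mod B"] assms(2,3) by simp
  then show "b = b'" using assms by simp
qed

lemma enc_col_le: "(\<And>j. p = Some j \<Longrightarrow> j \<in> {1..m}) \<Longrightarrow> enc_col p \<le> m"
  by (cases p) (auto simp: enc_col_def)

lemma enc_col_inj:
  "(\<And>j. p = Some j \<Longrightarrow> j \<in> {1..m}) \<Longrightarrow> (\<And>j. q = Some j \<Longrightarrow> j \<in> {1..m}) \<Longrightarrow> enc_col p = enc_col q \<Longrightarrow> p = q"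
  by (cases p; cases q) (auto simp: enc_col_def)

lemma sym_components:
  assumes "valid_sym n m s"
  shows "\<And>c. lpoint s = Some c \<Longrightarrow> c \<in> cells n m" "\<And>c. rpoint s = Some c \<Longrightarrow> c \<in> cells n m"
    "\<And>j. bpoint s = Some j \<Longrightarrow> j \<in> {1..m}"
  using assms unfolding valid_sym_def by blast+

lemma enc_sym_less:
  assumes "valid_sym n m s"
  shows "enc_sym n m s < sigma_size n m"
proof -
  note v = sym_components[OF assms]
  let ?B = "n * m + 1"
  have l: "enc_cell m (lpoint s) < ?B" "enc_cell m (rpoint s) < ?B" "enc_col (bpoint s) < m + 1"
    using enc_cell_le[of "lpoint s" n m] enc_cell_le[of "rpoint s" n m] enc_col_le[of "bpoint s" m] v by auto
  have "enc_col (bpoint s) * ?B + enc_cell m (rpoint s) < (m + 1) * ?B"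
    using l by (intro mixed_radix_less)
  then have "(enc_col (bpoint s) * ?B + enc_cell m (rpoint s)) * ?B + enc_cell m (lpoint s) < (m + 1) * ?B * ?B"
    using l by (intro mixed_radix_less)
  then have "((enc_col (bpoint s) * ?B + enc_cell m (rpoint s)) * ?B + enc_cell m (lpoint s)) * 2 + (if sval s then 1 else 0)
     < (m + 1) * ?B * ?B * 2"
    by (rule mixed_radix_less) simp
  then show ?thesis by (simp add: enc_sym_def sigma_size_def algebra_simps)
qed

text \<open>On valid symbols the encoding is a mixed-radix number with all digits in range. Hence
  equal codes mean equal symbols, which links the oracle to the query kernels.\<close>

lemma enc_sym_inj:
  assumes "valid_sym n m s" "valid_sym n m t" "enc_sym n m s = enc_sym n m t"
  shows "s = t"
proof -
  note v = sym_components[OF assms(1)] and w = sym_components[OF assms(2)]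
  let ?B = "n * m + 1"
  let ?a = "\<lambda>s. if sval s then 1 else 0 :: nat"
  let ?c = "\<lambda>s. enc_cell m (rpoint s) + ?B * enc_col (bpoint s)"
  let ?b = "\<lambda>s. enc_cell m (lpoint s) + ?B * ?c s"
  have l: "enc_cell m (lpoint s) < ?B" "enc_cell m (rpoint s) < ?B" "enc_cell m (lpoint t) < ?B" "enc_cell m (rpoint t) < ?B"
    using enc_cell_le[of "lpoint s" n m] enc_cell_le[of "rpoint s" n m] enc_cell_le[of "lpoint t" n m]
      enc_cell_le[of "rpoint t" n m] v w by auto
  have e1: "?a s + 2 * ?b s = ?a t + 2 * ?b t" using assms(3) by (simp only: enc_sym_def)
  have "?a s = ?a t" by (rule mixed_radix_inj(1)[OF e1]) auto
  then have val: "sval s = sval t" by (auto split: if_splits)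
  have e2: "?b s = ?b t" by (rule mixed_radix_inj(2)[OF e1]) auto
  have "enc_cell m (lpoint s) = enc_cell m (lpoint t)" by (rule mixed_radix_inj(1)[OF e2]) (use l in auto)
  then have lp: "lpoint s = lpoint t" using enc_cell_inj[of "lpoint s" n m "lpoint t"] v w by blast
  have e3: "?c s = ?c t" by (rule mixed_radix_inj(2)[OF e2]) (use l in auto)
  have "enc_cell m (rpoint s) = enc_cell m (rpoint t)" by (rule mixed_radix_inj(1)[OF e3]) (use l in auto)
  then have rp: "rpoint s = rpoint t" using enc_cell_inj[of "rpoint s" n m "rpoint t"] v w by blast
  have "enc_col (bpoint s) = enc_col (bpoint t)" by (rule mixed_radix_inj(2)[OF e3]) (use l in auto)
  then have bp: "bpoint s = bpoint t" using enc_col_inj[of "bpoint s" m "bpoint t"] v w by blast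
  show ?thesis using val lp rp bp by (cases s; cases t) (auto simp: sval_def lpoint_def rpoint_def bpoint_def)
qed

lemma sum_mixed_radix:
  fixes F :: "nat \<Rightarrow> real"
  shows "(\<Sum>i<A * B. F i) = (\<Sum>a<A. \<Sum>b<B. F (a * B + b))"
proof -
  have "(\<Sum>i<A * B. F i) = (\<Sum>a<A. sum F {a * B..<a * B + B})"
    by (rule sum.nat_group[symmetric])
  also have "\<dots> = (\<Sum>a<A. \<Sum>b<B. F (a * B + b))"
  proof (rule sum.cong[OF refl])
    fix a
    have "sum F {a * B..<a * B + B} = sum F {0 + a * B..<B + a * B}" by (simp add: add.commute)
    also have "\<dots> = (\<Sum>b\<in>{0..<B}. F (b + a * B))" by (rule sum.shift_bounds_nat_ivl)
    finally show "sum F {a * B..<a * B + B} = (\<Sum>b<B. F (a * B + b))"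
      by (simp add: add.commute atLeast0LessThan)
  qed
  finally show ?thesis .
qed

lemma sum_shift_mod:
  fixes F :: "nat \<Rightarrow> real"
  assumes "e < S"
  shows "(\<Sum>p<S. F ((p + S - e) mod S)) = (\<Sum>p<S. F p)"
proof (rule sum.reindex_bij_witness[where i = "\<lambda>p. (p + e) mod S" and j = "\<lambda>p. (p + S - e) mod S"])
  fix p assume p: "p \<in> {..<S}"
  show "((p + S - e) mod S + e) mod S = p"
    using p assms by (simp add: mod_add_left_eq)
next
  fix p assume p: "p \<in> {..<S}"
  have "p + S - e = p + (S - e)" using assms by simp
  have "((p + e) mod S + S - e) mod S = ((p + e) mod S + (S - e)) mod S" using assms by simp
  also have "\<dots> = (p + e + (S - e)) mod S" by (rule mod_add_left_eq)
  also have "\<dots> = p" using p assms by simp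
  finally show "((p + e) mod S + S - e) mod S = p" .
qed (use assms in auto)

text \<open>The effect of the oracle on the two halves of the catalyst: a register at 0 moves to the
  code \<open>e\<close>, and a register at \<open>- e\<close> moves to 0.\<close>

lemma shift_mod_eq_iff:
  fixes p e S :: nat
  assumes "p < S" "e < S"
  shows "(p + S - e) mod S = 0 \<longleftrightarrow> p = e" "(p + S - e) mod S = (S - e) mod S \<longleftrightarrow> p = 0"
proof -
  have "(p + S - e) mod S = (if e \<le> p then p - e else p + S - e)"
  proof (cases "e \<le> p")
    case True
    then have "p + S - e = (p - e) + S" using assms by simp
    then have "(p + S - e) mod S = (p - e) mod S" by (simp only: mod_add_self2)
    then show ?thesis using True assms by simp
  qed (use assms in simp)
  moreover have "(S - e) mod S = (if e = 0 then 0 else S - e)" using assms by simp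
  ultimately show "(p + S - e) mod S = 0 \<longleftrightarrow> p = e" "(p + S - e) mod S = (S - e) mod S \<longleftrightarrow> p = 0"
    using assms by (auto split: if_splits)
qed

text \<open>The basis vectors used by the algorithm: workspace values below \<open>N\<close> and in \<open>[N, 2 N)\<close> hold the two
  halves of the catalyst, \<open>2 N\<close> the start state and \<open>2 N + 1\<close>, \<open>2 N + 2\<close> the outcomes.  The last three have the query
  register in the uniform superposition, which every oracle fixes.\<close>

locale query_space =
  fixes n m N :: nat
  assumes nm: "n \<ge> 1" "m \<ge> 1"
begin

abbreviation "S \<equiv> sigma_size n m"
definition W :: nat where "W = 2 * N + 3"
abbreviation "qd \<equiv> qdim n m W"

lemma S_pos: "S > 0"
  by (simp add: sigma_size_def)

definition state :: "(nat \<Rightarrow> nat \<Rightarrow> nat \<Rightarrow> real) \<Rightarrow> nat \<Rightarrow> real" where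
  "state g i = g (i div (W * S)) ((i div W) mod S) (i mod W)"

lemma state_index:
  assumes "p < S" "w < W"
  shows "state g ((c * S + p) * W + w) = g c p w"
proof -
  have a: "((c * S + p) * W + w) div W = c * S + p" "((c * S + p) * W + w) mod W = w"
    using assms(2) by simp_all
  have "((c * S + p) * W + w) div (W * S) = ((c * S + p) * W + w) div W div S" by (rule div_mult2_eq)
  also have "\<dots> = c" using a assms by simp
  finally show ?thesis using a assms by (simp add: state_def)
qed

lemma sum_qd: "(\<Sum>i<qd. F (state g i) (state h i)) = (\<Sum>c<n * m. \<Sum>p<S. \<Sum>w<W. (F (g c p w) (h c p w) :: real))"
proof -
  have "(\<Sum>i<qd. F (state g i) (state h i)) = (\<Sum>c<n * m. \<Sum>p<S. \<Sum>w<W.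
      F (state g ((c * S + p) * W + w)) (state h ((c * S + p) * W + w)))"
    unfolding qdim_def sum_mixed_radix ..
  then show ?thesis by (simp add: state_index)
qed

lemma dot_state: "dot qd (state g) (state h) = (\<Sum>c<n * m. \<Sum>p<S. \<Sum>w<W. g c p w * h c p w)"
  unfolding dot_def by (rule sum_qd)

abbreviation "code x c \<equiv> enc_sym n m (x (cell_at m c)) mod S"

lemma roracle_state:
  assumes "i < qd"
  shows "roracle n m W x (state g) i = state (\<lambda>c p w. g c ((p + S - code x c) mod S) w) i"
proof -
  have "i mod W < W" by (simp add: W_def)
  then show ?thesis using assms S_pos
    by (simp add: roracle_def oracle_index_def Let_def state_index)
      (simp add: state_def cell_at_def)
qed

lemma state_surj: "\<exists>g. v = state g"
proof
  show "v = state (\<lambda>c p w. v ((c * S + p) * W + w))"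
  proof
    fix i
    have "i div (W * S) = i div W div S" by (rule div_mult2_eq)
    then show "v i = state (\<lambda>c p w. v ((c * S + p) * W + w)) i" by (simp add: state_def div_mult_mod_eq)
  qed
qed

text \<open>The oracle permutes the basis whatever the symbols are, since codes are reduced modulo
  \<open>S\<close>.\<close>

lemma dot_roracle: "dot qd (roracle n m W x v) (roracle n m W x w) = dot qd v w"
proof -
  obtain g h where gh: "v = state g" "w = state h" using state_surj by metis
  have "dot qd (roracle n m W x v) (roracle n m W x w)
     = dot qd (state (\<lambda>c p w. g c ((p + S - code x c) mod S) w)) (state (\<lambda>c p w. h c ((p + S - code x c) mod S) w))"
    unfolding gh by (intro dot_cong roracle_state)
  also have "\<dots> = dot qd (state g) (state h)"
    unfolding dot_state
    by (intro sum.cong refl sum_shift_mod[where F = "\<lambda>p. \<Sum>w<W. g c p w * h c p w" for c]) (use S_pos in simp)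
  finally show ?thesis by (simp add: gh)
qed

definition layout :: "(nat \<Rightarrow> nat \<Rightarrow> real) \<Rightarrow> (nat \<Rightarrow> nat \<Rightarrow> real) \<Rightarrow> (nat \<Rightarrow> nat) \<Rightarrow> (nat \<Rightarrow> nat) \<Rightarrow> real \<Rightarrow> real \<Rightarrow> bool
    \<Rightarrow> nat \<Rightarrow> nat \<Rightarrow> nat \<Rightarrow> real" where
  "layout t s P Q a b f c p w =
     (if w < N then of_bool (p = P c) * t c w
      else if w < 2 * N then of_bool (p = Q c) * s c (w - N)
      else of_bool (c = 0) / sqrt S * (if w = 2 * N then a else of_bool (w = 2 * N + 1 + of_bool f) * b))"

lemma sum_workspace:
  fixes F :: "nat \<Rightarrow> real"
  shows "(\<Sum>w<W. F w) = (\<Sum>w<N. F w) + (\<Sum>w<N. F (N + w)) + F (2 * N) + F (2 * N + 1) + F (2 * N + 2)"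
proof -
  have "W = Suc (Suc (Suc (2 * N)))" by (simp add: W_def)
  then have "(\<Sum>w<W. F w) = (\<Sum>w<2 * N. F w) + F (2 * N) + F (2 * N + 1) + F (2 * N + 2)" by simp
  moreover have "(\<Sum>w<2 * N. F w) = (\<Sum>w<N. F w) + (\<Sum>w<N. F (N + w))"
    using sum_mixed_radix[of F 2 N] by (simp add: numeral_2_eq_2)
  ultimately show ?thesis by simp
qed

lemma dot_layout:
  assumes P: "\<And>c. P c < S" "\<And>c. Q c < S"
  shows "dot qd (state (layout t s P Q a b f)) (state (layout t' s' P' Q' a' b' f')) =
    (\<Sum>c<n * m. of_bool (P c = P' c) * (\<Sum>w<N. t c w * t' c w) + of_bool (Q c = Q' c) * (\<Sum>w<N. s c w * s' c w))
    + a * a' + of_bool (f = f') * (b * b')"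
proof -
  have "dot qd (state (layout t s P Q a b f)) (state (layout t' s' P' Q' a' b' f')) =
    (\<Sum>c<n * m. \<Sum>p<S. of_bool (P c = p) * (of_bool (P c = P' c) * (\<Sum>w<N. t c w * t' c w))
      + of_bool (Q c = p) * (of_bool (Q c = Q' c) * (\<Sum>w<N. s c w * s' c w))
      + of_bool (0 = c) * ((a * a' + of_bool (f = f') * (b * b')) / S))"
  proof (unfold dot_state, intro sum.cong refl)
    fix c p
    let ?g = "layout t s P Q a b f c p" and ?h = "layout t' s' P' Q' a' b' f' c p"
    have "(\<Sum>w<N. ?g w * ?h w) = (\<Sum>w<N. of_bool (P c = p) * (of_bool (P c = P' c) * (t c w * t' c w)))"
      by (intro sum.cong refl) (auto simp: layout_def)
    then have 1: "(\<Sum>w<N. ?g w * ?h w) = of_bool (P c = p) * (of_bool (P c = P' c) * (\<Sum>w<N. t c w * t' c w))"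
      by (simp add: sum_distrib_left)
    have "(\<Sum>w<N. ?g (N + w) * ?h (N + w)) = (\<Sum>w<N. of_bool (Q c = p) * (of_bool (Q c = Q' c) * (s c w * s' c w)))"
      by (intro sum.cong refl) (auto simp: layout_def)
    then have 2: "(\<Sum>w<N. ?g (N + w) * ?h (N + w)) = of_bool (Q c = p) * (of_bool (Q c = Q' c) * (\<Sum>w<N. s c w * s' c w))"
      by (simp add: sum_distrib_left)
    have 3: "?g (2 * N) * ?h (2 * N) + ?g (2 * N + 1) * ?h (2 * N + 1) + ?g (2 * N + 2) * ?h (2 * N + 2)
       = of_bool (0 = c) * ((a * a' + of_bool (f = f') * (b * b')) / S)"
      by (cases f; cases f') (auto simp: layout_def add_divide_distrib)
    show "(\<Sum>w<W. ?g w * ?h w) = of_bool (P c = p) * (of_bool (P c = P' c) * (\<Sum>w<N. t c w * t' c w))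
      + of_bool (Q c = p) * (of_bool (Q c = Q' c) * (\<Sum>w<N. s c w * s' c w))
      + of_bool (0 = c) * ((a * a' + of_bool (f = f') * (b * b')) / S)"
      unfolding sum_workspace 1 2 using 3 by simp
  qed
  also have "\<dots> = (\<Sum>c<n * m. of_bool (P c = P' c) * (\<Sum>w<N. t c w * t' c w) + of_bool (Q c = Q' c) * (\<Sum>w<N. s c w * s' c w)
      + of_bool (0 = c) * (a * a' + of_bool (f = f') * (b * b')))"
    unfolding sum.distrib
    using P S_pos by (simp add: sum_of_bool_single flip: sum_distrib_right)
  also have "\<dots> = (\<Sum>c<n * m. of_bool (P c = P' c) * (\<Sum>w<N. t c w * t' c w) + of_bool (Q c = Q' c) * (\<Sum>w<N. s c w * s' c w))
    + (a * a' + of_bool (f = f') * (b * b'))"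
    using nm by (simp add: sum.distrib sum_of_bool_single[of "{..<n * m}" 0 "\<lambda>_. a * a' + of_bool (f = f') * (b * b')"])
  finally show ?thesis by simp
qed

lemma roracle_layout:
  assumes "i < qd"
  shows "roracle n m W x (state (layout t s (\<lambda>_. 0) (\<lambda>c. (S - code x c) mod S) a b f)) i
    = state (layout t s (code x) (\<lambda>_. 0) a b f) i"
proof -
  have "state (\<lambda>c p w. layout t s (\<lambda>_. 0) (\<lambda>c. (S - code x c) mod S) a b f c ((p + S - code x c) mod S) w) i
    = state (layout t s (code x) (\<lambda>_. 0) a b f) i"
    using shift_mod_eq_iff[of "(i div W) mod S" S "code x (i div (W * S))"] S_pos
    unfolding state_def layout_def by simp
  then show ?thesis using roracle_state[OF assms] by simp
qed

end

section \<open>From adversary kernels to algorithms\<close>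

context query_space
begin

lemma neg_code_eq_iff: "(S - code x c) mod S = (S - code y c) mod S \<longleftrightarrow> code x c = code y c"
proof -
  have neg: "(S - e) mod S = (if e = 0 then 0 else S - e)" if "e < S" for e
    using that by (cases "e = 0") simp_all
  have "(S - d) mod S = (S - e) mod S \<longleftrightarrow> d = e" if "d < S" "e < S" for d e
    unfolding neg[OF that(1)] neg[OF that(2)] using that by (cases "d = 0"; cases "e = 0") auto
  then show ?thesis using S_pos by simp
qed

text \<open>A query makes the first half of the catalyst distinguish inputs (register 0 to code) and
  makes the second half, which carries the sign \<open>\<sigma>\<close>, stop distinguishing them
  (minus code to 0). The net change of the Gram matrix is a sum over differing cells with factor
  \<open>1 - \<sigma> x * \<sigma> y\<close>. The factor vanishes for equal function values, where
  adversary vectors satisfy no constraint.\<close>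

lemma algorithm_from_vectors:
  fixes t :: "(cell \<Rightarrow> sym) \<Rightarrow> nat \<Rightarrow> nat \<Rightarrow> real" and K :: nat
  assumes fin: "finite I" and K: "K \<ge> 1" "400 * L \<le> real K"
    and sgn: "\<And>x. \<sigma> x = (if F x then 1 else - 1 :: real)"
    and gram: "\<And>x y. x \<in> I \<Longrightarrow> y \<in> I \<Longrightarrow>
      (\<Sum>c<n * m. (1 - of_bool (code x c = code y c)) * (1 - \<sigma> x * \<sigma> y) * (\<Sum>w<N. t x c w * t y c w)) = of_bool (F x \<noteq> F y)"
    and norm: "\<And>x. x \<in> I \<Longrightarrow> 2 * (\<Sum>c<n * m. \<Sum>w<N. (t x c w)\<^sup>2) \<le> L"
  obtains U where "\<And>k. k \<le> K \<Longrightarrow> orth qd (U k)"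
    "\<And>x. x \<in> I \<Longrightarrow> (\<Sum>i\<in>{i. i < qd \<and> i mod W = 2 * N + 1 + of_bool (F x)}. (run_real n m W x U K i)\<^sup>2) \<ge> 9 / 10"
proof -
  define r where "r = sqrt (real K)"
  have rr: "r * r = real K" "r > 0" using K by (simp_all add: r_def)
  define T where "T x y c = (\<Sum>w<N. t x c w * t y c w)" for x y c
  define ta where "ta x c w = t x c w / r" for x c w
  define tb where "tb x c w = \<sigma> x * t x c w / r" for x c w
  have taa: "(\<Sum>w<N. ta x c w * ta y c w) = T x y c / K" for x y c
    by (simp add: ta_def T_def sum_divide_distrib flip: rr(1))
  have tbb: "(\<Sum>w<N. tb x c w * tb y c w) = \<sigma> x * \<sigma> y * T x y c / K" for x y c
    by (simp add: tb_def T_def sum_divide_distrib sum_distrib_left mult_ac flip: rr(1))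
  \<comment> \<open>The ideal run: \<open>k / K\<close> of the squared amplitude has moved from the start state to the outcome, and the catalyst,
    scaled down by \<open>r\<close>, never changes.  Its Gram matrix changes per round exactly as one query changes that of the
    catalyst.\<close>
  define Psi where "Psi k x = state (layout (ta x) (tb x) (\<lambda>_. 0) (\<lambda>c. (S - code x c) mod S)
      (sqrt (real (K - k) / K)) (sqrt (real k / K)) (F x))" for k x
  define OPsi where "OPsi k x = state (layout (ta x) (tb x) (code x) (\<lambda>_. 0)
      (sqrt (real (K - k) / K)) (sqrt (real k / K)) (F x))" for k x
  have O: "roracle n m W x (Psi k x) i = OPsi k x i" if "i < qd" for k x i
    unfolding Psi_def OPsi_def by (rule roracle_layout[OF that])
  have Gram: "dot qd (OPsi k x) (OPsi k y) = dot qd (Psi (Suc k) x) (Psi (Suc k) y)"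
    if xy: "x \<in> I" "y \<in> I" and k: "k < K" for k x y
  proof -
    have l: "dot qd (OPsi k x) (OPsi k y) = (\<Sum>c<n * m. of_bool (code x c = code y c) * (T x y c / K) + \<sigma> x * \<sigma> y * T x y c / K)
        + real (K - k) / K + of_bool (F x = F y) * (real k / K)"
      unfolding OPsi_def by (subst dot_layout) (use S_pos in \<open>simp_all add: taa tbb\<close>)
    have r: "dot qd (Psi (Suc k) x) (Psi (Suc k) y) = (\<Sum>c<n * m. T x y c / K + of_bool (code x c = code y c) * (\<sigma> x * \<sigma> y * T x y c / K))
        + real (K - Suc k) / K + of_bool (F x = F y) * (real (Suc k) / K)"
      unfolding Psi_def by (subst dot_layout) (use S_pos in \<open>simp_all add: taa tbb neg_code_eq_iff del: of_nat_Suc\<close>)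
    have "(\<Sum>c<n * m. T x y c / K + of_bool (code x c = code y c) * (\<sigma> x * \<sigma> y * T x y c / K))
        - (\<Sum>c<n * m. of_bool (code x c = code y c) * (T x y c / K) + \<sigma> x * \<sigma> y * T x y c / K)
        = (\<Sum>c<n * m. (1 - of_bool (code x c = code y c)) * (1 - \<sigma> x * \<sigma> y) * T x y c) / K"
      unfolding sum_subtractf[symmetric] sum_divide_distrib
      by (intro sum.cong refl) (simp add: algebra_simps diff_divide_distrib add_divide_distrib)
    also have "\<dots> = of_bool (F x \<noteq> F y) / K" using gram[OF xy] by (simp add: T_def)
    finally have d: "(\<Sum>c<n * m. T x y c / K + of_bool (code x c = code y c) * (\<sigma> x * \<sigma> y * T x y c / K))
      = (\<Sum>c<n * m. of_bool (code x c = code y c) * (T x y c / K) + \<sigma> x * \<sigma> y * T x y c / K) + of_bool (F x \<noteq> F y) / K" by simp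
    have "real (K - Suc k) = real (K - k) - 1" using k by simp
    then show ?thesis unfolding l r d by (cases "F x = F y") (simp_all add: add_divide_distrib diff_divide_distrib)
  qed
  have "\<forall>k. \<exists>V. k < K \<longrightarrow> orth qd V \<and> (\<forall>x\<in>I. \<forall>i<qd. rmul qd V (OPsi k x) i = Psi (Suc k) x i)"
  proof
    fix k
    show "\<exists>V. k < K \<longrightarrow> orth qd V \<and> (\<forall>x\<in>I. \<forall>i<qd. rmul qd V (OPsi k x) i = Psi (Suc k) x i)"
      using gram_imp_orthogonal[OF fin, of qd "OPsi k" "Psi (Suc k)"] Gram by blast
  qed
  then obtain V where V: "\<And>k. k < K \<Longrightarrow> orth qd (V k)"
    "\<And>k x i. k < K \<Longrightarrow> x \<in> I \<Longrightarrow> i < qd \<Longrightarrow> rmul qd (V k) (OPsi k x) i = Psi (Suc k) x i" by metis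
  \<comment> \<open>With a zero catalyst and \<open>b = 0\<close> the registers and the outcome bit
    are immaterial. The start state is thus the same for all inputs, yet can be written with the
    registers of any \<open>Psi 0 x\<close>.\<close>
  define start where "start P = state (layout (\<lambda>_ _. 0) (\<lambda>_ _. 0) (\<lambda>_. 0) P 1 0 True)" for P
  have start_eq: "start P = state (layout (\<lambda>_ _. 0) (\<lambda>_ _. 0) (\<lambda>_. 0) Q 1 0 f)" for P Q f
    by (auto simp: start_def layout_def state_def)
  define s0 where "s0 = start (\<lambda>_. 0)"
  have qd0: "qd > 0" using nm S_pos by (simp add: qdim_def W_def)
  have "dot qd (\<lambda>i. if i = 0 then 1 else 0) (\<lambda>i. if i = 0 then 1 else 0) = (\<Sum>i<qd. if i = 0 then 1 else 0)"
    unfolding dot_def by (intro sum.cong) auto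
  then have "dot qd (\<lambda>i. if i = 0 then 1 else 0) (\<lambda>i. if i = 0 then 1 else 0) = 1"
    using qd0 by simp
  moreover have "dot qd s0 s0 = 1"
    unfolding s0_def start_def by (subst dot_layout) (use S_pos in simp_all)
  ultimately obtain U0 where U0: "orth qd U0" "\<And>i. i < qd \<Longrightarrow> rmul qd U0 (\<lambda>i. if i = 0 then 1 else 0) i = s0 i"
    using householder[of qd "\<lambda>i. if i = 0 then 1 else 0" s0] by metis
  define U where "U k = (case k of 0 \<Rightarrow> U0 | Suc k \<Rightarrow> V k)" for k
  have close: "dot qd (\<lambda>i. run_real n m W x U k i - Psi k x i) (\<lambda>i. run_real n m W x U k i - Psi k x i) \<le> L / K"
    if x: "x \<in> I" and k: "k \<le> K" for x k
    using k
  proof (induction k)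
    case 0
    \<comment> \<open>The initial error is the missing catalyst. Later rounds apply the same
      isometries to the actual and to the ideal run, so its norm never changes.\<close>
    let ?e = "state (layout (\<lambda>c w. - ta x c w) (\<lambda>c w. - tb x c w) (\<lambda>_. 0) (\<lambda>c. (S - code x c) mod S) 0 0 (F x))"
    have "dot qd (\<lambda>i. run_real n m W x U 0 i - Psi 0 x i) (\<lambda>i. run_real n m W x U 0 i - Psi 0 x i) = dot qd ?e ?e"
    proof -
      have "run_real n m W x U 0 i - Psi 0 x i = ?e i" if i: "i < qd" for i
      proof -
        have "run_real n m W x U 0 i = state (layout (\<lambda>_ _. 0) (\<lambda>_ _. 0) (\<lambda>_. 0) (\<lambda>c. (S - code x c) mod S) 1 0 (F x)) i"
          using U0(2)[OF i] by (simp add: U_def s0_def start_eq[of _ "\<lambda>c. (S - code x c) mod S" "F x"])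
        then show ?thesis using K by (simp add: Psi_def state_def layout_def)
      qed
      then show ?thesis by (intro dot_cong)
    qed
    also have "\<dots> = (\<Sum>c<n * m. T x x c / K + \<sigma> x * \<sigma> x * T x x c / K)"
      by (subst dot_layout) (use S_pos in \<open>simp_all add: taa tbb\<close>)
    also have "\<dots> = 2 * (\<Sum>c<n * m. T x x c) / K"
      by (simp add: sgn sum_divide_distrib sum_distrib_left)
    also have "\<dots> \<le> L / K"
      using norm[OF x] by (intro divide_right_mono) (simp_all add: T_def power2_eq_square)
    finally show ?case .
  next
    case (Suc k)
    then have k: "k < K" by simp
    let ?d = "\<lambda>i. run_real n m W x U k i - Psi k x i"
    let ?z = "\<lambda>i. run_real n m W x U (Suc k) i - Psi (Suc k) x i"
    have step: "?z i = rmul qd (V k) (roracle n m W x ?d) i" if i: "i < qd" for i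
    proof -
      have "rmul qd (V k) (OPsi k x) = rmul qd (V k) (roracle n m W x (Psi k x))"
        by (rule rmul_cong) (simp add: O)
      then have "?z i = rmul qd (V k) (roracle n m W x (run_real n m W x U k)) i - rmul qd (V k) (roracle n m W x (Psi k x)) i"
        using V(2)[OF k x i] by (simp add: U_def)
      also have "\<dots> = rmul qd (V k) (\<lambda>i. roracle n m W x (run_real n m W x U k) i - roracle n m W x (Psi k x) i) i"
        by (rule rmul_diff[OF i])
      also have "(\<lambda>i. roracle n m W x (run_real n m W x U k) i - roracle n m W x (Psi k x) i) = roracle n m W x ?d"
        by (auto simp: roracle_def)
      finally show ?thesis .
    qed
    have "dot qd ?z ?z = dot qd (rmul qd (V k) (roracle n m W x ?d)) (rmul qd (V k) (roracle n m W x ?d))"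
      by (intro dot_cong step)
    also have "\<dots> = dot qd ?d ?d" by (simp add: dot_rmul[OF V(1)[OF k]] dot_roracle)
    also have "\<dots> \<le> L / K" using Suc.IH k by simp
    finally show ?case .
  qed
  show ?thesis
  proof (rule that[of U])
    fix k assume "k \<le> K"
    then show "orth qd (U k)" using U0(1) V(1) by (cases k) (auto simp: U_def)
  next
    fix x assume x: "x \<in> I"
    define w0 where "w0 = 2 * N + 1 + (of_bool (F x) :: nat)"
    define A where "A = {i. i < qd \<and> i mod W = w0}"
    let ?r = "run_real n m W x U K"
    have A: "finite A" "A \<subseteq> {..<qd}" by (auto simp: A_def)
    have "(\<Sum>i\<in>A. (?r i - Psi K x i)\<^sup>2) \<le> (\<Sum>i<qd. (?r i - Psi K x i)\<^sup>2)"
      by (rule sum_mono2) (use A in auto)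
    also have "\<dots> \<le> L / K" using close[OF x, of K] by (simp add: dot_def power2_eq_square)
    \<comment> \<open>Source of the factor 400 in the hypothesis on \<open>K\<close>; the ideal run
      has norm 1 on the correct outcome, so 19/20 remains.\<close>
    also have "\<dots> \<le> (1 / 20)\<^sup>2" using K by (simp add: divide_le_eq power2_eq_square)
    finally have err: "L2_set (\<lambda>i. ?r i - Psi K x i) A \<le> 1 / 20"
      unfolding L2_set_def by (rule real_le_lsqrt[rotated]) simp
    have "(\<Sum>i\<in>A. (Psi K x i)\<^sup>2) = (\<Sum>i<qd. of_bool (i mod W = w0) * (Psi K x i)\<^sup>2)"
    proof -
      have "(\<Sum>i<qd. of_bool (i mod W = w0) * (Psi K x i)\<^sup>2) = (\<Sum>i<qd. if i mod W = w0 then (Psi K x i)\<^sup>2 else 0)"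
        by (intro sum.cong) auto
      also have "\<dots> = (\<Sum>i\<in>{i \<in> {..<qd}. i mod W = w0}. (Psi K x i)\<^sup>2)"
        by (rule sum.inter_filter[symmetric]) simp
      finally show ?thesis by (simp add: A_def)
    qed
    also have "\<dots> = dot qd (state (layout (\<lambda>_ _. 0) (\<lambda>_ _. 0) (\<lambda>_. 0) (\<lambda>_. 0) 0 1 (F x))) (state (layout (\<lambda>_ _. 0) (\<lambda>_ _. 0) (\<lambda>_. 0) (\<lambda>_. 0) 0 1 (F x)))"
      unfolding dot_def using K
      by (intro sum.cong refl) (auto simp: Psi_def state_def layout_def w0_def power2_eq_square)
    also have "\<dots> = 1"
      by (subst dot_layout) (use S_pos in simp_all)
    finally have one: "L2_set (Psi K x) A = 1" by (simp add: L2_set_def)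
    have "L2_set (Psi K x) A = L2_set (\<lambda>i. ?r i + (Psi K x i - ?r i)) A" by simp
    also have "\<dots> \<le> L2_set ?r A + L2_set (\<lambda>i. Psi K x i - ?r i) A" by (rule L2_set_triangle_ineq)
    also have "L2_set (\<lambda>i. Psi K x i - ?r i) A = L2_set (\<lambda>i. ?r i - Psi K x i) A"
      by (simp add: L2_set_def power2_commute)
    finally have "19 / 20 \<le> L2_set ?r A" using one err by simp
    then have "(19 / 20)\<^sup>2 \<le> (L2_set ?r A)\<^sup>2" by (intro power_mono) auto
    also have "\<dots> = (\<Sum>i\<in>A. (?r i)\<^sup>2)" by (simp add: L2_set_def sum_nonneg)
    finally show "(\<Sum>i\<in>{i. i < qd \<and> i mod W = 2 * N + 1 + of_bool (F x)}. (?r i)\<^sup>2) \<ge> 9 / 10"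
      by (simp add: A_def w0_def power2_eq_square)
  qed
qed

end

section \<open>Reduction to the finite set of inputs, and the resulting algorithm\<close>

definition restrict_input :: "nat \<Rightarrow> nat \<Rightarrow> (cell \<Rightarrow> sym) \<Rightarrow> cell \<Rightarrow> sym" where
  "restrict_input n m x = (\<lambda>c. if c \<in> cells n m then x c else triv)"

lemma restrict_input_in_inputs: "valid_input n m x \<Longrightarrow> restrict_input n m x \<in> inputs n m"
  by (auto simp: restrict_input_def inputs_def valid_input_def)

lemma run_real_restrict_input:
  assumes "m \<ge> 1"
  shows "run_real n m W (restrict_input n m x) U k = run_real n m W x U k"
proof -
  have "roracle n m W (restrict_input n m x) v = roracle n m W x v" for v
  proof
    fix i
    show "roracle n m W (restrict_input n m x) v i = roracle n m W x v i"
    proof (cases "i < qdim n m W")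
      case True
      have "qdim n m W = n * m * (W * sigma_size n m)" by (simp add: qdim_def)
      then have "i div (W * sigma_size n m) < n * m" using True by (simp only: less_mult_imp_div_less)
      then have "cell_at m (i div (W * sigma_size n m)) \<in> cells n m"
        using bij_betwE[OF bij_cell_at[OF assms]] by auto
      then show ?thesis
        by (simp add: roracle_def oracle_index_def Let_def restrict_input_def cell_at_def)
    qed (simp add: roracle_def)
  qed
  then show ?thesis by (induction k) simp_all
qed

lemma adm_imp_computes_with_queries:
  assumes nm: "n \<ge> 1" "m \<ge> 1"
    and adm: "adversary.adm (cells n m) {x \<in> inputs n m. F x} {x \<in> inputs n m. \<not> F x} (\<lambda>_ _. 1) (\<lambda>_. L) (\<lambda>_. L)"
    and K: "K \<ge> 1" "400 * L \<le> real K"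
    and F: "\<And>x. valid_input n m x \<Longrightarrow> F (restrict_input n m x) = F x"
  shows "computes_with_queries n m F K"
proof -
  interpret adversary "cells n m" "{x \<in> inputs n m. F x}" "{x \<in> inputs n m. \<not> F x}"
    by unfold_locales (use finite_cells finite_inputs in auto)
  from adm obtain I u v where I: "finite (I :: nat set)"
    and one: "\<And>x y. x \<in> inputs n m \<Longrightarrow> F x \<Longrightarrow> y \<in> inputs n m \<Longrightarrow> \<not> F y \<Longrightarrow>
      1 = (\<Sum>c\<in>cells n m. \<Sum>w\<in>I. if x c = y c then 0 else u x c w * v y c w)"
    and u: "\<And>x. x \<in> inputs n m \<Longrightarrow> F x \<Longrightarrow> (\<Sum>c\<in>cells n m. \<Sum>w\<in>I. (u x c w)\<^sup>2) \<le> L"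
    and v: "\<And>y. y \<in> inputs n m \<Longrightarrow> \<not> F y \<Longrightarrow> (\<Sum>c\<in>cells n m. \<Sum>w\<in>I. (v y c w)\<^sup>2) \<le> L"
    unfolding adm_def by blast
  obtain N where N: "I \<subseteq> {..<N}" using I unfolding finite_nat_set_iff_bounded by auto
  interpret query_space n m N by unfold_locales (use nm in auto)
  define \<sigma> where "\<sigma> x = (if F x then 1 else - 1 :: real)" for x
  define q where "q x c w = (if F x then u x c w else v x c w)" for x c w
  \<comment> \<open>The factor \<open>1 - \<sigma> x * \<sigma> y\<close> is 2 on pairs with
    different values, which \<open>sqrt 2\<close> compensates; the two halves of the catalyst then
    have total squared norm at most \<open>L\<close>.\<close>
  define t where "t x k w = of_bool (w \<in> I) * q x (cell_at m k) w / sqrt 2" for x k w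
  have tI: "(\<Sum>w<N. t x k w * t y k w) = (\<Sum>w\<in>I. q x (cell_at m k) w * q y (cell_at m k) w) / 2" for x y k
  proof -
    have "(\<Sum>w<N. t x k w * t y k w) = (\<Sum>w<N. if w \<in> I then q x (cell_at m k) w * q y (cell_at m k) w / 2 else 0)"
      by (intro sum.cong) (auto simp: t_def)
    also have "\<dots> = (\<Sum>w\<in>{..<N} \<inter> I. q x (cell_at m k) w * q y (cell_at m k) w / 2)"
      by (rule sum.inter_restrict[symmetric]) simp
    also have "{..<N} \<inter> I = I" using N by auto
    finally show ?thesis by (simp add: sum_divide_distrib)
  qed
  have reindex: "(\<Sum>k<n * m. G (cell_at m k)) = (\<Sum>c\<in>cells n m. G c)" for G :: "cell \<Rightarrow> real"
    by (rule sum.reindex_bij_betw[OF bij_cell_at[OF nm(2)]])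
  have code_iff: "code x k = code y k \<longleftrightarrow> x (cell_at m k) = y (cell_at m k)"
    if "x \<in> inputs n m" "y \<in> inputs n m" "k < n * m" for x y k
  proof -
    have "cell_at m k \<in> cells n m" using bij_betwE[OF bij_cell_at[OF nm(2)]] that(3) by auto
    then have v: "valid_sym n m (x (cell_at m k))" "valid_sym n m (y (cell_at m k))"
      using that by (auto simp: inputs_def valid_input_def)
    then show ?thesis using enc_sym_inj[OF v] enc_sym_less[OF v(1)] enc_sym_less[OF v(2)] by auto
  qed
  have gram_pos: "(\<Sum>k<n * m. (1 - of_bool (code x k = code y k)) * (1 - \<sigma> x * \<sigma> y) * (\<Sum>w<N. t x k w * t y k w)) = 1"
    if x: "x \<in> inputs n m" "F x" and y: "y \<in> inputs n m" "\<not> F y" for x y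
  proof -
    have "(\<Sum>k<n * m. (1 - of_bool (code x k = code y k)) * (1 - \<sigma> x * \<sigma> y) * (\<Sum>w<N. t x k w * t y k w))
      = (\<Sum>k<n * m. \<Sum>w\<in>I. if x (cell_at m k) = y (cell_at m k) then 0 else u x (cell_at m k) w * v y (cell_at m k) w)"
      using code_iff[OF x(1) y(1)] x(2) y(2) by (intro sum.cong refl) (simp add: tI q_def \<sigma>_def)
    also have "\<dots> = 1"
      using one[OF x y] reindex[of "\<lambda>c. \<Sum>w\<in>I. if x c = y c then 0 else u x c w * v y c w"] by simp
    finally show ?thesis .
  qed
  obtain U where U: "\<And>k. k \<le> K \<Longrightarrow> orth qd (U k)"
    "\<And>x. x \<in> inputs n m \<Longrightarrow> (\<Sum>i\<in>{i. i < qd \<and> i mod W = 2 * N + 1 + of_bool (F x)}. (run_real n m W x U K i)\<^sup>2) \<ge> 9 / 10"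
  proof (rule algorithm_from_vectors[OF finite_inputs[of n m] K, of \<sigma> F t])
    fix x y assume xy: "x \<in> inputs n m" "y \<in> inputs n m"
    show "(\<Sum>k<n * m. (1 - of_bool (code x k = code y k)) * (1 - \<sigma> x * \<sigma> y) * (\<Sum>w<N. t x k w * t y k w)) = of_bool (F x \<noteq> F y)"
    proof (cases "F x = F y")
      case True
      then show ?thesis by (simp add: \<sigma>_def)
    next
      case False
      then consider "F x" "\<not> F y" | "\<not> F x" "F y" by blast
      then show ?thesis
      proof cases
        case 1
        then show ?thesis using gram_pos[OF xy(1) _ xy(2)] by simp
      next
        case 2
        have "(\<Sum>k<n * m. (1 - of_bool (code x k = code y k)) * (1 - \<sigma> x * \<sigma> y) * (\<Sum>w<N. t x k w * t y k w))
          = (\<Sum>k<n * m. (1 - of_bool (code y k = code x k)) * (1 - \<sigma> y * \<sigma> x) * (\<Sum>w<N. t y k w * t x k w))"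
          by (simp only: eq_commute[of "code x k" for k] mult.commute[of "\<sigma> x"] mult.commute[of "t x k w" for k w])
        then show ?thesis using gram_pos[OF xy(2) _ xy(1)] 2 by simp
      qed
    qed
  next
    fix x assume x: "x \<in> inputs n m"
    have "2 * (\<Sum>k<n * m. \<Sum>w<N. (t x k w)\<^sup>2) = (\<Sum>k<n * m. 2 * (\<Sum>w<N. t x k w * t x k w))"
      by (simp only: power2_eq_square sum_distrib_left)
    also have "\<dots> = (\<Sum>k<n * m. \<Sum>w\<in>I. (q x (cell_at m k) w)\<^sup>2)"
      unfolding tI by (simp add: power2_eq_square)
    also have "\<dots> = (\<Sum>c\<in>cells n m. \<Sum>w\<in>I. (q x c w)\<^sup>2)"
      by (rule reindex[of "\<lambda>c. \<Sum>w\<in>I. (q x c w)\<^sup>2"])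
    also have "\<dots> \<le> L" using u[OF x] v[OF x] by (cases "F x") (simp_all add: q_def)
    finally show "2 * (\<Sum>k<n * m. \<Sum>w<N. (t x k w)\<^sup>2) \<le> L" .
  qed (auto simp: \<sigma>_def)
  let ?Us = "map (\<lambda>k i j. complex_of_real (U k i j)) [0..<Suc K]"
  let ?out = "\<lambda>i. i mod W = 2 * N + 2"
  show ?thesis
    unfolding computes_with_queries_def
  proof (intro exI[of _ W] exI[of _ ?Us] exI[of _ ?out] conjI allI impI)
    show "W > 0" by (simp add: W_def)
    show "length ?Us = K + 1" by simp
    show "\<forall>U\<in>set ?Us. unitary_mat qd U" using U(1) by (auto intro!: unitary_of_real)
    fix x assume x: "valid_input n m x"
    define x' where "x' = restrict_input n m x"
    have x': "x' \<in> inputs n m" "F x' = F x" using restrict_input_in_inputs[OF x] F[OF x] by (simp_all add: x'_def)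
    have "9 / 10 \<le> (\<Sum>i\<in>{i. i < qd \<and> i mod W = 2 * N + 1 + of_bool (F x)}. (run_real n m W x U K i)\<^sup>2)"
      using U(2)[OF x'(1)] run_real_restrict_input[OF nm(2)] x'(2) by (simp add: x'_def)
    also have "\<dots> \<le> (\<Sum>i\<in>{i. i < qd \<and> ?out i = F x}. (run_real n m W x U K i)\<^sup>2)"
      by (rule sum_mono2) (auto simp: of_bool_def split: if_splits)
    also have "\<dots> = success_prob n m W ?Us ?out x (F x)"
      unfolding success_prob_def run_alg_of_real by simp
    finally show "9 / 10 \<le> success_prob n m W ?Us ?out x (F x)" .
  qed
qed

lemma follow_restrict_input:
  assumes "valid_input n m x" "a \<in> cells n m"
  shows "follow (restrict_input n m x) a ds = follow x a ds"
  using assms(2)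
proof (induction ds arbitrary: a)
  case (Cons d ds)
  have "valid_sym n m (x a)" using assms(1) Cons.prems by (auto simp: valid_input_def)
  then have "a' \<in> cells n m" if "(if d then rpoint (x a) else lpoint (x a)) = Some a'" for a'
    using that sym_components by (auto split: if_splits)
  then show ?case using Cons by (auto simp: restrict_input_def split: option.split)
qed simp

lemma good_leaf_restrict_input:
  assumes "valid_input n m x" "a \<in> cells n m"
  shows "good_leaf m (restrict_input n m x) a j b \<longleftrightarrow> good_leaf m x a j b"
  using follow_in_cells[OF assms] unfolding good_leaf_def follow_restrict_input[OF assms]
  by (auto simp: restrict_input_def)

lemma f_nm_restrict_input:
  assumes x: "valid_input n m x"
  shows "f_nm n m (restrict_input n m x) = f_nm n m x"
proof -
  let ?x = "restrict_input n m x"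
  have x': "valid_input n m ?x" using x by (auto simp: valid_input_def restrict_input_def)
  have eq: "?x c = x c" if "b \<in> {1..m}" "c \<in> column n b" for b c
    using that by (auto simp: restrict_input_def cells_def)
  have ones: "all_ones_col n ?x b = all_ones_col n x b" if "b \<in> {1..m}" for b
    using eq[OF that] by (auto simp: all_ones_col_def)
  have cell: "a \<in> cells n m" if "b \<in> {1..m}" "a \<in> column n b" for a b using that by (auto simp: cells_def)
  show ?thesis
  proof
    assume "f_nm n m ?x"
    then obtain b a where *: "b \<in> {1..m}" "all_ones_col n ?x b" "a \<in> column n b" "?x a \<noteq> triv"
      "\<And>c. c \<in> column n b \<Longrightarrow> ?x c \<noteq> triv \<Longrightarrow> c = a"
      "\<And>j. j \<in> {1..m} - {b} \<Longrightarrow> good_leaf m ?x a j b" by (rule f_nm_certificate) blast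
    show "f_nm n m x"
    proof (rule f_nmI[OF x *(1) _ *(3)])
      show "all_ones_col n x b" using *(2) ones[OF *(1)] by simp
      show "x a \<noteq> triv" using *(4) unfolding eq[OF *(1,3)] .
      show "c = a" if "c \<in> column n b" "x c \<noteq> triv" for c
        using *(5)[OF that(1)] that(2) unfolding eq[OF *(1) that(1)] by blast
      show "good_leaf m x a j b" if "j \<in> {1..m} - {b}" for j
        using *(6)[OF that] unfolding good_leaf_restrict_input[OF x cell[OF *(1,3)]] .
    qed
  next
    assume "f_nm n m x"
    then obtain b a where *: "b \<in> {1..m}" "all_ones_col n x b" "a \<in> column n b" "x a \<noteq> triv"
      "\<And>c. c \<in> column n b \<Longrightarrow> x c \<noteq> triv \<Longrightarrow> c = a"
      "\<And>j. j \<in> {1..m} - {b} \<Longrightarrow> good_leaf m x a j b" by (rule f_nm_certificate) blast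
    show "f_nm n m ?x"
    proof (rule f_nmI[OF x' *(1) _ *(3)])
      show "all_ones_col n ?x b" using *(2) ones[OF *(1)] by simp
      show "?x a \<noteq> triv" using *(4) unfolding eq[OF *(1,3)] .
      show "c = a" if "c \<in> column n b" "?x c \<noteq> triv" for c
        using *(5)[OF that(1)] that(2) unfolding eq[OF *(1) that(1)] by blast
      show "good_leaf m ?x a j b" if "j \<in> {1..m} - {b}" for j
        using *(6)[OF that] unfolding good_leaf_restrict_input[OF x cell[OF *(1,3)]] .
    qed
  qed
qed

section \<open>Depth of the tree and the final estimate\<close>

lemma length_tree_path: "length (tree_path m j) \<le> tlog m + 1"
  by (auto simp: tree_path_def bin_path_def Let_def)

lemma two_power_tlog_le:
  assumes "m \<ge> 1"
  shows "2 ^ tlog m \<le> m"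
proof (cases "tlog m")
  case (Suc k)
  then have "\<not> m < 2 ^ (k + 1)" unfolding tlog_def by (intro not_less_Least) simp
  then show ?thesis using Suc by simp
qed (use assms in simp)

lemma tlog_le:
  assumes "m \<ge> 1"
  shows "real (tlog m) \<le> 2 * ln (real m)"
proof -
  have "real (2 ^ tlog m) \<le> real m" using two_power_tlog_le[OF assms] by (simp only: of_nat_le_iff)
  then have "ln (2 ^ tlog m) \<le> ln (real m)" using assms by (subst ln_le_cancel_iff) auto
  then have "real (tlog m) * ln 2 \<le> ln (real m)" by (simp add: ln_realpow)
  \<comment> \<open>This is \<open>ln 2 \<ge> 1 / 2\<close>, the origin of the factor 2 in the
    bound.\<close>
  moreover have "ln (1 / 2 :: real) \<le> 1 / 2 - 1" by (rule ln_le_minus_one) simp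
  then have "real (tlog m) * (1 / 2) \<le> real (tlog m) * ln 2"
    by (intro mult_left_mono) (simp_all add: ln_div)
  ultimately show ?thesis by simp
qed

theorem theorem5:
  shows "\<exists>C k. \<forall>n m. n \<ge> 1 \<longrightarrow> m \<ge> 1 \<longrightarrow>
           real (Q_query n m (f_nm n m))
             \<le> C * (sqrt (real n) + sqrt (real m)) * (1 + ln (real n + real m)) ^ k"
\<comment> \<open>The cost is at most \<open>17 * s * l * (2 * l)\<close>, and
  \<open>400 * 34 = 13600\<close>; the remaining 2 comes from rounding \<open>K\<close> and is
  absorbed because \<open>s * l\<^sup>2 \<ge> 1\<close>. One logarithm is the depth of the tree, the
  other the mean length of the walk.\<close>
proof (rule exI[of _ 13602], rule exI[of _ 2], intro allI impI)
  fix n m :: nat assume n: "n \<ge> 1" and m: "m \<ge> 1"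
  define d where "d = 2 * ln (real m) + 2"
  interpret grid n m d
  proof
    fix j
    show "real (length (tree_path m j)) + 1 \<le> d"
      using length_tree_path[of m j] tlog_le[OF m] by (simp add: d_def)
  qed (use n m in auto)
  define s where "s = sqrt (real n) + sqrt (real m)"
  define l where "l = 1 + ln (real n + real m)"
  have l: "l \<ge> 1" "ln (real m) \<le> l - 1" "ln (1 + real n) \<le> l - 1" using n m by (simp_all add: l_def)
  have sn: "sqrt (real n) \<ge> 1" "sqrt (real m) \<ge> 1" using n m by simp_all
  have s: "s \<ge> 1" using sn unfolding s_def by linarith
  define K where "K = nat \<lceil>400 * total_cost\<rceil> + 1"
  have tc: "total_cost \<ge> 0"
    unfolding total_cost_def using step_cost_ge_1 by (intro mult_nonneg_nonneg) (auto simp: add_nonneg_nonneg)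
  have K: "400 * total_cost \<le> real K" unfolding K_def by linarith
  have "computes_with_queries n m (f_nm n m) K"
    by (rule adm_imp_computes_with_queries[OF n m adm_total _ K f_nm_restrict_input]) (simp_all add: K_def)
  then have "Q_query n m (f_nm n m) \<le> K" unfolding Q_query_def by (rule Least_le)
  also have "real K \<le> 400 * total_cost + 2" unfolding K_def using tc by linarith
  also have "total_cost \<le> 17 * s * l * (2 * l)"
    unfolding total_cost_def
  proof (rule mult_mono)
    have "d \<le> 2 * l" using l by (simp add: d_def)
    then have "sqrt m * d \<le> sqrt m * (2 * l)" by (intro mult_left_mono) auto
    moreover have "sqrt n \<le> sqrt n * l" using l sn by (simp add: mult_le_cancel_left1)
    moreover have "sqrt m * l \<ge> 0" using l by simp
    \<comment> \<open>16 is 5 for the step itself plus 11 from \<open>direct_cost\<close>; the final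
      1 is absorbed into a seventeenth \<open>sqrt n\<close>.\<close>
    moreover have "step_cost = 16 * sqrt n + 2 * (sqrt m * d) + 1" "sqrt m * (2 * l) = 2 * (sqrt m * l)"
      by (simp_all add: step_cost_def direct_cost_def verify_cost_def)
    ultimately have "step_cost \<le> 17 * (sqrt n * l) + 4 * (sqrt m * l)"
      using sn by linarith
    also have "\<dots> \<le> 17 * s * l" using \<open>sqrt m * l \<ge> 0\<close> by (simp add: s_def algebra_simps)
    finally show "step_cost \<le> 17 * s * l" .
    show "2 + ln (1 + real n) \<le> 2 * l" using l by simp
  qed (use s l in auto)
  finally have "real (Q_query n m (f_nm n m)) \<le> 13600 * (s * l\<^sup>2) + 2"
    by (simp add: power2_eq_square)
  moreover have "1 * 1 \<le> s * l\<^sup>2" using s l by (intro mult_mono) (auto simp: one_le_power)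
  ultimately show "real (Q_query n m (f_nm n m)) \<le> 13602 * (sqrt (real n) + sqrt (real m)) * (1 + ln (real n + real m)) ^ 2"
    by (simp add: s_def[symmetric] l_def[symmetric])
qed

end
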